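(* Let $k\ge 1$ be an integer and let $G$ be a finite simple graph of order $n$ with $2k+2\le n\le 4k+1$. If $e(G)\ge \binom{2k+1}{2}+\binom{n-2k}{2}$, then $G$ contains cycles of every length $4,6,8,\dots,2k+2$, unless $G\cong K_1\vee(K_{2k}\cup K_{n-2k-1})$.
   Context: $e(G)$ is the number of edges of $G$. $K_m$ is the complete graph on $m$ vertices, $G_1\cup G_2$ the disjoint union, and $G_1\vee G_2$ the join (disjoint union together with all edges between $G_1$ and $G_2$). *)

theory Defs
  imports Main
begin

definition simple_graph :: "'a set \<Rightarrow> 'a set set \<Rightarrow> bool" where
  "simple_graph V E \<longleftrightarrow> finite V \<and> (\<forall>e\<in>E. \<exists>u v. u \<in> V \<and> v \<in> V \<and> u \<noteq> v \<and> e = {u, v})"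

definition has_cycle :: "'a set \<Rightarrow> 'a set set \<Rightarrow> nat \<Rightarrow> bool" where
  "has_cycle V E L \<longleftrightarrow> L \<ge> 3 \<and> (\<exists>vs. length vs = L \<and> distinct vs \<and> set vs \<subseteq> V \<and>
      (\<forall>i<L. {vs ! i, vs ! ((i + 1) mod L)} \<in> E))"

definition graph_iso :: "'a set \<Rightarrow> 'a set set \<Rightarrow> 'b set \<Rightarrow> 'b set set \<Rightarrow> bool" where
  "graph_iso V E V' E' \<longleftrightarrow> (\<exists>f. bij_betw f V V' \<and>
      (\<forall>u\<in>V. \<forall>v\<in>V. {u, v} \<in> E \<longleftrightarrow> {f u, f v} \<in> E'))"

text \<open>The graph K_1 join (K_a disjoint-union K_b) on vertex set {0..a+b}:
  vertex 0 is the K_1, vertices 1..a form K_a, vertices a+1..a+b form K_b.\<close>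
definition join_verts :: "nat \<Rightarrow> nat \<Rightarrow> nat set" where
  "join_verts a b = {0..a+b}"

definition join_edges :: "nat \<Rightarrow> nat \<Rightarrow> nat set set" where
  "join_edges a b =
     {{0, i} | i. 1 \<le> i \<and> i \<le> a + b}
   \<union> {{i, j} | i j. i \<noteq> j \<and> 1 \<le> i \<and> i \<le> a \<and> 1 \<le> j \<and> j \<le> a}
   \<union> {{i, j} | i j. i \<noteq> j \<and> a < i \<and> i \<le> a + b \<and> a < j \<and> j \<le> a + b}"

end

theory Submission
  imports Defs
begin

text \<open>Induction on \<^term>\<open>n\<close> with \<^term>\<open>k\<close> fixed. A vertex of degree at most
  $n-2k-1$ can be deleted: the edge bound drops by exactly $n-2k-1$, and the extremal graph with one more
  vertex is inspected by hand. Otherwise the minimum degree is at least $n-2k$, so that a cut vertex would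
  leave too few edges, and Kopylov's argument (a path in a 2-connected graph yields a cycle as long as the
  path or as the degree sum of its ends on it; compare the $(k+1)$-core with a slightly larger core in an
  edge-maximal graph) gives a cycle of length at least $2k+2\ge n/2$. Now the graph has more than $n^2/4$
  edges unless $n=4k$. A vertex off a longest cycle has low degree, so deleting such vertices
  keeps this inequality and leads to a Hamiltonian graph, which is pancyclic by Bondy's counting. If
  $n=4k$, the minimum degree is at least $n/2$, the longest cycle is Hamiltonian, and either a cycle of
  length $n-1$ together with the remaining vertex gives all lengths, or the graph is complete bipartite
  along the cycle.\<close>

section \<open>Paths, cycles and arcs\<close>

text \<open>Write j = n - 2k. Twice the edge bound is (2k+1)2k + j(j-1), the arc count of two
  cliques on 2k+1 and j vertices that share one vertex, which is the extremal graph. Its clique on j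
  vertices contains vertices of degree j-1, so minimum degree j is exactly what expels it; this is
  why the induction splits at degree j-1 and why the later counts can be strict. The obstacle is
  K_{2k,2k}: for n = 4k it has exactly 4k^2 edges, meets the bound and has no odd cycle. Hence the
  theorem speaks of even lengths only, and Bondy's counting cannot cover n = 4k. In general 4e(G) -
  n^2 is at least d(d+2) with d = 2k - j. This is positive for d \<ge> 1, zero for n = 4k, and -1
  for n = 4k + 1, where the minimum degree, then more than n/2, has to supply the missing edges. In
  Kopylov's argument the larger core is taken for the threshold a + 1 with a = 2k + 2 - |H|, H being
  the smaller core: a clique vertex of degree |H| - 1 and an outer vertex of degree a + 1 together
  just reach the wanted length 2k + 2.\<close>

definition path :: "('a \<Rightarrow> 'a \<Rightarrow> bool) \<Rightarrow> 'a set \<Rightarrow> 'a list \<Rightarrow> bool" where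
  "path A W xs \<longleftrightarrow> xs \<noteq> [] \<and> distinct xs \<and> set xs \<subseteq> W \<and> successively A xs"

definition cycle :: "('a \<Rightarrow> 'a \<Rightarrow> bool) \<Rightarrow> 'a set \<Rightarrow> 'a list \<Rightarrow> bool" where
  "cycle A W xs \<longleftrightarrow> path A W xs \<and> 3 \<le> length xs \<and> A (last xs) (hd xs)"

definition deg :: "('a \<Rightarrow> 'a \<Rightarrow> bool) \<Rightarrow> 'a set \<Rightarrow> 'a \<Rightarrow> nat" where
  "deg A W v = card {u \<in> W. A v u}"

text \<open>Every edge inside \<^term>\<open>W\<close> contributes two arcs; counting arcs avoids all divisions by two.\<close>

definition arcs :: "('a \<Rightarrow> 'a \<Rightarrow> bool) \<Rightarrow> 'a set \<Rightarrow> nat" where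
  "arcs A W = (\<Sum>v\<in>W. deg A W v)"

lemma path_nonempty: "path A W xs \<Longrightarrow> xs \<noteq> []"
  by (simp add: path_def)

lemma path_length_pos: "path A W xs \<Longrightarrow> 0 < length xs"
  by (simp add: path_def)

lemma path_distinct: "path A W xs \<Longrightarrow> distinct xs"
  by (simp add: path_def)

lemma path_subset: "path A W xs \<Longrightarrow> set xs \<subseteq> W"
  by (simp add: path_def)

lemma path_nth: "path A W xs \<Longrightarrow> i < length xs \<Longrightarrow> xs ! i \<in> W"
  by (auto simp: path_def)

lemma path_step: "path A W xs \<Longrightarrow> Suc i < length xs \<Longrightarrow> A (xs ! i) (xs ! Suc i)"
  by (auto simp: path_def successively_nth)

lemma path_hd: "path A W xs \<Longrightarrow> hd xs = xs ! 0"
  by (simp add: path_def hd_conv_nth)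

lemma path_last: "path A W xs \<Longrightarrow> last xs = xs ! (length xs - 1)"
  by (simp add: path_def last_conv_nth)

lemma path_mono: "path A W xs \<Longrightarrow> W \<subseteq> W' \<Longrightarrow> path A W' xs"
  by (auto simp: path_def)

lemma path_single: "x \<in> W \<Longrightarrow> path A W [x]"
  by (simp add: path_def)

lemma path_append:
  "path A W xs \<Longrightarrow> path A W ys \<Longrightarrow> set xs \<inter> set ys = {} \<Longrightarrow> A (last xs) (hd ys)
   \<Longrightarrow> path A W (xs @ ys)"
  by (auto simp: path_def successively_append_iff)

lemma path_append_left: "path A W (xs @ ys) \<Longrightarrow> xs \<noteq> [] \<Longrightarrow> path A W xs"
  by (auto simp: path_def successively_append_iff)

lemma path_append_right: "path A W (xs @ ys) \<Longrightarrow> ys \<noteq> [] \<Longrightarrow> path A W ys"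
  by (auto simp: path_def successively_append_iff)

lemma path_append_adj: "path A W (xs @ ys) \<Longrightarrow> xs \<noteq> [] \<Longrightarrow> ys \<noteq> [] \<Longrightarrow> A (last xs) (hd ys)"
  by (auto simp: path_def successively_append_iff)

lemma path_take: "path A W xs \<Longrightarrow> 0 < i \<Longrightarrow> path A W (take i xs)"
  by (rule path_append_left[where ys = "drop i xs"]) (auto dest: path_nonempty)

lemma path_drop: "path A W xs \<Longrightarrow> i < length xs \<Longrightarrow> path A W (drop i xs)"
  by (rule path_append_right[where xs = "take i xs"]) (auto dest: path_nonempty)

lemma path_Cons: "path A W xs \<Longrightarrow> x \<in> W \<Longrightarrow> x \<notin> set xs \<Longrightarrow> A x (hd xs) \<Longrightarrow> path A W (x # xs)"
  using path_append[of A W "[x]" xs] by (simp add: path_single)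

lemma path_length_le: "path A W xs \<Longrightarrow> finite W \<Longrightarrow> length xs \<le> card W"
  by (metis card_mono distinct_card path_distinct path_subset)

lemma last_take_Suc: "i < length xs \<Longrightarrow> last (take (Suc i) xs) = xs ! i"
  by (simp add: take_Suc_conv_app_nth)

lemma set_take_nth: "set (take i xs) = {xs ! j | j. j < i \<and> j < length xs}"
  by (auto simp: in_set_conv_nth) (metis nth_take)+

lemma set_drop_nth: "set (drop i xs) = {xs ! j | j. i \<le> j \<and> j < length xs}"
proof -
  have "\<exists>k<length xs - i. xs ! (i + k) = xs ! j" if "i \<le> j" "j < length xs" for j
    using that by (intro exI[of _ "j - i"]) auto
  then show ?thesis
    by (auto simp: in_set_conv_nth) (metis add.commute le_add2 less_diff_conv)
qed

lemma set_slice_nth: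
  assumes "j < length xs"
  shows "set (drop i (take (Suc j) xs)) = {xs ! l | l. i \<le> l \<and> l \<le> j}"
proof -
  have "{take (Suc j) xs ! l | l. i \<le> l \<and> l < Suc j} = {xs ! l | l. i \<le> l \<and> l \<le> j}"
    by (rule Collect_cong) (metis le_imp_less_Suc less_Suc_eq_le nth_take)
  then show ?thesis using assms by (simp add: set_drop_nth)
qed

lemma card_nth:
  assumes "distinct xs"
  shows "card {u \<in> set xs. P u} = card {i. i < length xs \<and> P (xs ! i)}"
proof -
  have "bij_betw ((!) xs) {i. i < length xs \<and> P (xs ! i)} {u \<in> set xs. P u}"
    using assms by (auto simp: bij_betw_def inj_on_def nth_eq_iff_index_eq in_set_conv_nth)
  then show ?thesis by (simp add: bij_betw_same_card)
qed

lemma cycle_path: "cycle A W xs \<Longrightarrow> path A W xs"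
  by (simp add: cycle_def)

lemma cycle_mono: "cycle A W xs \<Longrightarrow> W \<subseteq> W' \<Longrightarrow> cycle A W' xs"
  by (auto simp: cycle_def intro: path_mono)

lemma cycle_length_le: "cycle A W xs \<Longrightarrow> finite W \<Longrightarrow> length xs \<le> card W"
  by (auto simp: cycle_def intro: path_length_le)

lemma cycle_rotate1: assumes "cycle A W xs" shows "cycle A W (rotate1 xs)"
proof -
  obtain x ys where xs: "xs = x # ys" "ys \<noteq> []"
    using assms by (cases xs; cases "tl xs") (auto simp: cycle_def path_def)
  then show ?thesis
    using assms by (auto simp: cycle_def path_def successively_append_iff successively_Cons)
qed

lemma cycle_rotate: "cycle A W xs \<Longrightarrow> cycle A W (rotate i xs)"
  by (induction i) (auto intro: cycle_rotate1)

lemma cycle_rotate_hd: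
  assumes "cycle A W xs" "x \<in> set xs"
  obtains ys where "cycle A W ys" "set ys = set xs" "length ys = length xs" "hd ys = x"
proof -
  obtain i where "i < length xs" "xs ! i = x"
    using assms(2) by (auto simp: in_set_conv_nth)
  moreover have "xs \<noteq> []" using assms(2) by auto
  ultimately have "hd (rotate i xs) = x" by (simp add: hd_rotate_conv_nth)
  then show ?thesis using that[of "rotate i xs"] cycle_rotate[OF assms(1)] by simp
qed

text \<open>The vertex set stays outside the locale. Deleting a vertex then only shrinks
  \<open>W\<close>, and the locale is entered anew only where an edge is added to
  \<open>A\<close>.\<close>

locale sgraph =
  fixes A :: "'a \<Rightarrow> 'a \<Rightarrow> bool"
  assumes sym: "A x y \<Longrightarrow> A y x" and irrefl: "\<not> A x x"
begin

lemma sym_iff: "A x y \<longleftrightarrow> A y x"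
  using sym by blast

lemma path_rev: "path A W xs \<Longrightarrow> path A W (rev xs)"
  unfolding path_def using sym by (auto elim: successively_mono)

lemma deg_le:
  assumes "finite W" "v \<in> W" shows "deg A W v \<le> card W - 1"
proof -
  have "deg A W v \<le> card (W - {v})"
    unfolding deg_def using assms irrefl by (intro card_mono) auto
  then show ?thesis using assms by simp
qed

lemma deg_remove_self: "deg A (W - {v}) v = deg A W v"
  unfolding deg_def using irrefl by (auto intro!: arg_cong[where f = card])

lemma deg_insert:
  assumes "finite W" "v \<notin> W"
  shows "deg A (insert v W) u = deg A W u + (if A u v then 1 else 0)"
proof -
  have "{w \<in> insert v W. A u w} = (if A u v then insert v {w \<in> W. A u w} else {w \<in> W. A u w})"
    by auto
  then show ?thesis using assms by (auto simp: deg_def)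
qed

lemma arcs_insert:
  assumes "finite W" "v \<notin> W"
  shows "arcs A (insert v W) = arcs A W + 2 * deg A W v"
proof -
  have "(\<Sum>u\<in>W. if A u v then 1 else 0::nat) = card {u \<in> W. A v u}"
    using assms(1) by (subst sum.inter_filter[symmetric]) (auto simp: sym_iff[of v])
  then show ?thesis
    using assms by (simp add: arcs_def deg_insert sum.distrib irrefl) (simp add: deg_def)
qed

lemma arcs_remove: "finite W \<Longrightarrow> v \<in> W \<Longrightarrow> arcs A W = arcs A (W - {v}) + 2 * deg A W v"
  using arcs_insert[of "W - {v}" v] by (simp add: insert_absorb deg_remove_self)

lemma arcs_le: "finite W \<Longrightarrow> arcs A W \<le> card W * (card W - 1)"
  unfolding arcs_def using sum_bounded_above[of W "deg A W" "card W - 1"] deg_le by simp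

text \<open>The edges to the two ends of the path cross, and the cycle avoids what lies between them.\<close>

lemma crossing_cycle:
  assumes p: "path A W xs" and ij: "i < j" "j < length xs" "3 \<le> Suc i + (length xs - j)"
    and a: "A (hd xs) (xs ! j)" "A (last xs) (xs ! i)"
  shows "\<exists>ys. cycle A W ys \<and> length ys = Suc i + (length xs - j)"
proof -
  let ?ys = "take (Suc i) xs @ rev (drop j xs)"
  have d: "distinct xs" using p by (rule path_distinct)
  have lt: "last (take (Suc i) xs) = xs ! i" using ij by (simp add: last_take_Suc)
  have "path A W ?ys"
  proof (rule path_append)
    show "path A W (take (Suc i) xs)" using p by (simp add: path_take)
    show "path A W (rev (drop j xs))" using p ij by (intro path_rev path_drop)
    show "set (take (Suc i) xs) \<inter> set (rev (drop j xs)) = {}"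
      using d ij set_take_disj_set_drop_if_distinct[of xs "Suc i" j] by auto
    show "A (last (take (Suc i) xs)) (hd (rev (drop j xs)))"
      using ij a sym by (simp add: lt hd_rev)
  qed
  moreover have "last ?ys = xs ! j"
    using ij by (simp add: last_rev hd_drop_conv_nth)
  moreover have "hd ?ys = hd xs" using ij by (cases xs) auto
  moreover have "length ?ys = Suc i + (length xs - j)" using ij by simp
  ultimately show ?thesis using ij a sym by (intro exI[of _ ?ys]) (auto simp: cycle_def)
qed

end

section \<open>Two disjoint paths\<close>

text \<open>Absence of a cut vertex, phrased by the paths that \<open>two_disjoint_paths\<close>
  uses to bypass a given vertex.\<close>

definition biconnected :: "('a \<Rightarrow> 'a \<Rightarrow> bool) \<Rightarrow> 'a set \<Rightarrow> bool" where
  "biconnected A W \<longleftrightarrow> (\<forall>w\<in>W. \<forall>x\<in>W - {w}. \<forall>y\<in>W - {w}.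
      \<exists>xs. path A (W - {w}) xs \<and> hd xs = x \<and> last xs = y)"

text \<open>Cut at the first vertex in \<open>Y\<close>, then start from the last vertex in
  \<open>X\<close> before it. In this order the second cut cannot bring back a vertex of
  \<open>Y\<close>.\<close>

lemma path_segment:
  assumes p: "path A W xs" and "hd xs \<in> X" "last xs \<in> Y"
  obtains ys where "path A W ys" "set ys \<subseteq> set xs"
    "set ys \<inter> X = {hd ys}" "set ys \<inter> Y = {last ys}"
proof -
  have "\<exists>y\<in>set xs. y \<in> Y"
    using assms(3) last_in_set[OF path_nonempty[OF p]] by blast
  then obtain ps y qs where xs: "xs = ps @ y # qs" and y: "y \<in> Y" and ps: "\<forall>z\<in>set ps. z \<notin> Y"
    using split_list_first_prop[of xs "\<lambda>y. y \<in> Y"] by blast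
  let ?us = "ps @ [y]"
  have us: "path A W ?us" using p xs path_append_left[of A W "ps @ [y]" qs] by simp
  have "\<exists>z\<in>set ?us. z \<in> X"
    using assms(2) xs by (cases ps) auto
  then obtain as x bs where us': "?us = as @ x # bs" and x: "x \<in> X" and bs: "\<forall>z\<in>set bs. z \<notin> X"
    using split_list_last_prop[of ?us "\<lambda>y. y \<in> X"] by blast
  let ?ys = "x # bs"
  have l: "last ?ys = y" using us' by (metis last_appendR last_snoc list.distinct(1))
  have sub: "set ?ys \<subseteq> set ?us" using us' by (metis Un_upper2 set_append)
  show ?thesis
  proof (rule that[of ?ys])
    show "path A W ?ys" using us us' path_append_right[of A W as ?ys] by simp
    show "set ?ys \<subseteq> set xs" using sub xs by auto
    show "set ?ys \<inter> X = {hd ?ys}" using x bs by auto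
    have "y \<in> set ?ys" using l last_in_set[of ?ys] by simp
    then show "set ?ys \<inter> Y = {last ?ys}" using l sub ps y by auto
  qed
qed

text \<open>The rerouting step of the augmentation: come in along \<open>z\<close> and follow
  \<open>q\<close> from \<open>y\<close> on. Since \<open>z\<close> may meet \<open>T\<close> only
  in \<open>y\<close>, the new path still meets \<open>T\<close> just at the old end.\<close>

lemma path_splice:
  assumes z: "path A W z" and q: "path A W (q1 @ y # q2)"
    and y: "last z = y" and zq: "set z \<inter> set (q1 @ y # q2) = {y}"
    and qT: "set (q1 @ y # q2) \<inter> T = {last (q1 @ y # q2)}" and zT: "set z \<inter> T \<subseteq> {y}"
    and qS: "set q2 \<inter> S = {}" and zS: "set z \<inter> S = {hd z}"
  shows "path A W (z @ q2)" "hd (z @ q2) = hd z" "last (z @ q2) = last (q1 @ y # q2)"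
    "set (z @ q2) \<inter> S = {hd z}" "set (z @ q2) \<inter> T = {last (q1 @ y # q2)}"
    "set (z @ q2) \<subseteq> set z \<union> set (q1 @ y # q2)"
proof -
  have zne: "z \<noteq> []" using z by (rule path_nonempty)
  have yq: "y \<notin> set q2" using q by (auto simp: path_def)
  have yz: "y \<in> set z" using zq by auto
  have d: "set z \<inter> set q2 = {}" using zq yq by auto
  show "path A W (z @ q2)"
  proof (cases "q2 = []")
    case False
    have "path A W (y # q2)" using q path_append_right by blast
    then have "path A W q2" "A y (hd q2)"
      using False path_append_right[of A W "[y]" q2] path_append_adj[of A W "[y]" q2] by auto
    then show ?thesis using z d y by (intro path_append) auto
  qed (use z in simp)
  show "hd (z @ q2) = hd z" using zne by simp
  show l: "last (z @ q2) = last (q1 @ y # q2)" using y by auto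
  show "set (z @ q2) \<inter> S = {hd z}" using qS zS by auto
  show "set (z @ q2) \<subseteq> set z \<union> set (q1 @ y # q2)" by auto
  have "last (z @ q2) \<in> set (z @ q2)" using zne by (intro last_in_set) simp
  moreover have "set z \<inter> T \<subseteq> {last (q1 @ y # q2)}"
  proof -
    have "set z \<inter> T \<subseteq> set (q1 @ y # q2) \<inter> T" using zT by auto
    then show ?thesis unfolding qT .
  qed
  moreover have "set q2 \<inter> T \<subseteq> {last (q1 @ y # q2)}"
  proof -
    have "set q2 \<inter> T \<subseteq> set (q1 @ y # q2) \<inter> T" by auto
    then show ?thesis unfolding qT .
  qed
  moreover have "last (q1 @ y # q2) \<in> T" using qT by blast
  ultimately show "set (z @ q2) \<inter> T = {last (q1 @ y # q2)}" unfolding l set_append by blast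
qed

text \<open>Menger's theorem for two paths, in its augmenting form: the two disjoint paths
  keep the ends of the given path.\<close>

lemma two_disjoint_paths:
  assumes bi: "biconnected A W"
    and T: "T \<subseteq> W" "\<And>w. T - {w} \<noteq> {}"
  shows "path A W P \<Longrightarrow> S \<subseteq> W \<Longrightarrow> (\<And>w. S - {w} \<noteq> {}) \<Longrightarrow> set P \<inter> S = {hd P} \<Longrightarrow>
    set P \<inter> T = {last P} \<Longrightarrow>
    \<exists>Q R. path A W Q \<and> path A W R \<and> set Q \<inter> set R = {} \<and>
      set Q \<inter> S = {hd Q} \<and> set Q \<inter> T = {last Q} \<and>
      set R \<inter> S = {hd R} \<and> set R \<inter> T = {last R} \<and> hd Q = hd P \<and> last P \<in> {last Q, last R}"
proof (induction P arbitrary: S rule: induct_list012)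
  case 1
  then show ?case by (simp add: path_def)
next
  case (2 a)
  have a: "a \<in> W" "a \<in> S" "a \<in> T" using "2.prems" by (auto simp: path_def)
  obtain s t where st: "s \<in> S - {a}" "t \<in> T - {a}" using "2.prems"(3) T(2) by blast
  then obtain xs where xs: "path A (W - {a}) xs" "hd xs = s" "last xs = t"
    using bi a "2.prems"(2) T(1) unfolding biconnected_def by blast
  obtain ys where ys: "path A (W - {a}) ys" "set ys \<subseteq> set xs" "set ys \<inter> S = {hd ys}"
    "set ys \<inter> T = {last ys}"
    using path_segment[OF xs(1), of S T] xs(2,3) st by blast
  show ?case
  proof (intro exI conjI)
    show "path A W [a]" using a by (simp add: path_single)
    show "path A W ys" using ys(1) by (rule path_mono) auto
    show "set [a] \<inter> set ys = {}" using path_subset[OF ys(1)] by auto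
  qed (use a ys in auto)
next
  case (3 a p ps)
  let ?P' = "p # ps"
  have P: "path A W (a # ?P')" by fact
  have P': "path A W ?P'" using P path_append_right[of A W "[a]" ?P'] by simp
  have aW: "a \<in> W" "p \<in> W" and ap: "A a p" and anP: "a \<notin> set ?P'"
    using P by (auto simp: path_def)
  have aS: "a \<in> S" and PS: "set ?P' \<inter> S = {}" using "3.prems"(4) anP by auto
  have lP: "last (a # ?P') = last ?P'" by simp
  have aT: "a \<notin> T"
  proof
    assume "a \<in> T"
    then have "a = last ?P'" using "3.prems"(5) by auto
    then show False using anP by (metis last_in_set list.distinct(1))
  qed
  have P'T: "set ?P' \<inter> T = {last ?P'}" using "3.prems"(5) aT by auto
  \<comment> \<open>Enlarging \<open>S\<close> by \<open>p\<close> lets the shorter path start in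
    the set. Prepending \<open>a\<close> to \<open>Q\<close> then returns to the old
    \<open>S\<close>, unless \<open>R\<close> starts at \<open>a\<close> as well.\<close>
  have "\<exists>Q R. path A W Q \<and> path A W R \<and> set Q \<inter> set R = {} \<and>
      set Q \<inter> insert p S = {hd Q} \<and> set Q \<inter> T = {last Q} \<and>
      set R \<inter> insert p S = {hd R} \<and> set R \<inter> T = {last R} \<and> hd Q = hd ?P' \<and>
      last ?P' \<in> {last Q, last R}"
    using P' "3.prems"(2,3) aW PS P'T by (intro "3.IH"(2)) auto
  then obtain Q R where Q: "path A W Q" and R: "path A W R" and QR: "set Q \<inter> set R = {}"
    and QS: "set Q \<inter> insert p S = {p}" and QT: "set Q \<inter> T = {last Q}"
    and RS: "set R \<inter> insert p S = {hd R}" and RT: "set R \<inter> T = {last R}" and hQ: "hd Q = p"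
    and lQR: "last ?P' \<in> {last Q, last R}"
    by auto
  have ne: "Q \<noteq> []" "R \<noteq> []" using Q R path_nonempty by auto
  have pQ: "p \<in> set Q" using hQ ne by auto
  have hR: "hd R \<in> S" "hd R \<noteq> p" using RS QR pQ ne by auto
  have RS': "set R \<inter> S = {hd R}" using RS QR pQ hR by auto
  have pS: "p \<notin> S" using PS by auto
  have QS': "set Q \<inter> S = {}" using QS pS by auto
  have aQ: "a \<notin> set Q" using QS' aS by auto
  have aQ': "path A W (a # Q)" using Q aW aQ hQ ap by (intro path_Cons) auto
  have aQS: "set (a # Q) \<inter> S = {a}" using QS' aS by auto
  have aQT: "set (a # Q) \<inter> T = {last (a # Q)}" using QT aT ne by auto
  have goal: ?case if "path A W Q'" "path A W R'" "set Q' \<inter> set R' = {}"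
      "set Q' \<inter> S = {a}" "hd Q' = a" "set Q' \<inter> T = {last Q'}"
      "set R' \<inter> S = {hd R'}" "set R' \<inter> T = {last R'}" "last ?P' \<in> {last Q', last R'}"
    for Q' R'
    using that by (intro exI[of _ Q'] exI[of _ R']) simp
  have laQ: "last (a # Q) = last Q" using ne by simp
  show ?case
  proof (cases "hd R = a")
    case False
    have "a = hd R" if "a \<in> set R" using that aS RS' by (metis IntI singletonD)
    then have "a \<notin> set R" using False by blast
    then have "set (a # Q) \<inter> set R = {}" using QR by auto
    then show ?thesis
      using goal[OF aQ' R _ aQS _ aQT RS' RT] lQR laQ by simp
  next
    case True
    \<comment> \<open>Now \<open>a # Q\<close> and \<open>R\<close> share their start. A path
      \<open>Z\<close> that avoids \<open>a\<close> takes over the one it hits first, and the other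
      one keeps \<open>a\<close>.\<close>
    obtain s t where st: "s \<in> S - {a}" "t \<in> T - {a}" using "3.prems"(3) T(2) by blast
    then obtain xs where xs: "path A (W - {a}) xs" "hd xs = s" "last xs = t"
      using bi aW "3.prems"(2) T(1) unfolding biconnected_def by blast
    have "hd xs \<in> S" "last xs \<in> T \<union> set Q \<union> set R" using xs(2,3) st by simp_all
    then obtain Z where Z': "path A (W - {a}) Z" "set Z \<subseteq> set xs" "set Z \<inter> S = {hd Z}"
      "set Z \<inter> (T \<union> set Q \<union> set R) = {last Z}"
      by (rule path_segment[OF xs(1)])
    have Z: "path A W Z" using Z'(1) by (rule path_mono) auto
    have aZ: "a \<notin> set Z" using path_subset[OF Z'(1)] by auto
    have Zne: "Z \<noteq> []" using Z path_nonempty by auto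
    define y where "y = last Z"
    have ZT: "set Z \<inter> T \<subseteq> {y}" and ZQ: "set Z \<inter> set Q \<subseteq> {y}" and ZR: "set Z \<inter> set R \<subseteq> {y}"
      and yZ: "y \<in> set Z"
      using Z'(4) last_in_set[OF Zne] unfolding y_def by blast+
    consider "y \<in> set Q" | "y \<in> set R" | "y \<in> T" "y \<notin> set Q" "y \<notin> set R" using Z'(4) y_def by blast
    then show ?thesis
    proof cases
      case 1
      then obtain q1 q2 where q: "Q = q1 @ y # q2" by (auto simp: in_set_conv_decomp)
      have zq: "set Z \<inter> set (q1 @ y # q2) = {y}" using ZQ yZ 1 q by blast
      have q2S: "set q2 \<inter> S = {}" using QS' q by auto
      note sp = path_splice[OF Z Q[unfolded q] y_def[symmetric] zq QT[unfolded q] ZT q2S Z'(3), folded q]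
      have RZ: "set R \<inter> set (Z @ q2) = {}" using ZR 1 q QR by auto
      have RSa: "set R \<inter> S = {a}" using RS' True by simp
      have lRZ: "last ?P' \<in> {last R, last (Z @ q2)}" using lQR unfolding sp(3) by blast
      show ?thesis
        by (rule goal[OF R sp(1) RZ RSa True RT _ _ lRZ]) (simp_all only: sp(2-5))
    next
      case 2
      then obtain q1 q2 where q: "R = q1 @ y # q2" by (auto simp: in_set_conv_decomp)
      have "q1 \<noteq> []" using q True aZ yZ by auto
      then have hq2: "hd R \<notin> set q2" using q path_distinct[OF R] by (cases q1) auto
      have "set q2 \<inter> S \<subseteq> set R \<inter> S" using q by auto
      then have q2S: "set q2 \<inter> S = {}" using hq2 unfolding RS' by blast
      have zq: "set Z \<inter> set (q1 @ y # q2) = {y}" using ZR yZ 2 q by blast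
      note sp = path_splice[OF Z R[unfolded q] y_def[symmetric] zq RT[unfolded q] ZT q2S Z'(3), folded q]
      have "a \<notin> set q2" using q2S aS by auto
      then have QZ: "set (a # Q) \<inter> set (Z @ q2) = {}" using aZ ZQ 2 QR unfolding q by auto
      have lQZ: "last ?P' \<in> {last (a # Q), last (Z @ q2)}" using lQR unfolding sp(3) laQ .
      show ?thesis
        by (rule goal[OF aQ' sp(1) QZ aQS _ aQT _ _ lQZ]) (simp_all only: sp(2-5) list.sel)
    next
      case 3
      have ZT': "set Z \<inter> T = {last Z}" using ZT 3 yZ y_def by auto
      show ?thesis
      \<comment> \<open>\<open>Z\<close> runs into \<open>T\<close> without touching
        \<open>Q\<close> or \<open>R\<close>. It replaces a path that does not end where
        \<open>P\<close> ends, so this end survives.\<close>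
      proof (cases "last ?P' = last Q")
        case True
        have QZ: "set (a # Q) \<inter> set Z = {}" using aZ ZQ 3 by auto
        show ?thesis
          by (rule goal[OF aQ' Z QZ aQS _ aQT Z'(3) ZT']) (simp_all only: True laQ list.sel insert_iff simp_thms)
      next
        case False
        have RZ: "set R \<inter> set Z = {}" using ZR 3 by auto
        have RSa: "set R \<inter> S = {a}" using RS' True by simp
        show ?thesis
          by (rule goal[OF R Z RZ RSa True RT Z'(3) ZT']) (use lQR False in blast)
      qed
    qed
  qed
qed

section \<open>A long cycle from a long path in a biconnected graph\<close>

lemma path_join:
  assumes p: "path A W xs" and q: "path A W ys" and e: "last xs = hd ys"
    and d: "set xs \<inter> set ys = {last xs}"
  shows "path A W (xs @ tl ys)" "hd (xs @ tl ys) = hd xs" "last (xs @ tl ys) = last ys"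
    "set (xs @ tl ys) = set xs \<union> set ys"
proof -
  obtain y zs where ys: "ys = y # zs" using path_nonempty[OF q] by (cases ys) auto
  have ne: "xs \<noteq> []" using path_nonempty[OF p] .
  have y: "last xs = y" using e ys by simp
  show "hd (xs @ tl ys) = hd xs" using ne by simp
  show "last (xs @ tl ys) = last ys" using y ys by simp
  have yx: "y \<in> set xs" using last_in_set[OF ne] y by simp
  then show "set (xs @ tl ys) = set xs \<union> set ys" using ys by auto
  show "path A W (xs @ tl ys)"
  proof (cases "zs = []")
    case False
    have "path A W zs" using q ys False path_append_right[of A W "[y]" zs] by simp
    moreover have "A y (hd zs)" using q ys False path_append_adj[of A W "[y]" zs] by simp
    moreover have "set xs \<inter> set zs = {}"
    proof -
      have "set xs \<inter> set zs \<subseteq> {y}" using d unfolding y ys by auto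
      moreover have "y \<notin> set zs" using path_distinct[OF q] ys by simp
      ultimately show ?thesis by blast
    qed
    ultimately show ?thesis using p ys y by (auto intro: path_append)
  qed (use p ys in simp)
qed

context sgraph begin

text \<open>The interior of \<open>ys\<close>, reversed, closes \<open>xs\<close>. If it is empty,
  \<open>ys\<close> is an edge and \<open>xs\<close> itself is the cycle, hence the bound 3.\<close>

lemma two_paths_cycle:
  assumes p: "path A W xs" and q: "path A W ys" and h: "hd xs = hd ys" and l: "last xs = last ys"
    and ne: "hd xs \<noteq> last xs" and d: "set xs \<inter> set ys \<subseteq> {hd xs, last xs}" and len: "3 \<le> length xs"
  shows "\<exists>zs. cycle A W zs \<and> length xs \<le> length zs"
proof -
  have yne: "ys \<noteq> []" using path_nonempty[OF q] .
  obtain y ys' where ys': "ys = y # ys'" using yne by (cases ys) auto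
  have "ys' \<noteq> []" using ne h l ys' by (cases "ys' = []") auto
  then obtain mid z where mid: "ys' = mid @ [z]" by (cases ys' rule: rev_cases) auto
  have ys: "ys = y # mid @ [z]" using ys' mid by simp
  have y: "y = hd xs" and z: "z = last xs" using h l ys by auto
  have xne: "xs \<noteq> []" using path_nonempty[OF p] .
  show ?thesis
  proof (cases "mid = []")
    case True
    then have "A (hd xs) (last xs)" using q ys y z by (simp add: path_def)
    then show ?thesis using p len sym by (auto simp: cycle_def)
  next
    case False
    have m: "path A W mid"
      using q ys False path_append_right[of A W "[y]" "mid @ [z]"] path_append_left[of A W mid "[z]"]
      by simp
    have a1: "A y (hd mid)" using q ys False path_append_adj[of A W "[y]" "mid @ [z]"] by simp
    have a2: "A (last mid) z" using q ys False path_append_adj[of A W "y # mid" "[z]"] by simp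
    have yz: "y \<notin> set mid" "z \<notin> set mid" using path_distinct[OF q] ys by auto
    have sub: "set mid \<subseteq> set ys" using ys by auto
    have "set xs \<inter> set mid = {}" using d yz y z sub by blast
    then have "path A W (xs @ rev mid)"
      using p m False a2 z sym by (intro path_append path_rev) (auto simp: hd_rev)
    then have "cycle A W (xs @ rev mid)"
      using len a1 y False xne sym by (auto simp: cycle_def last_rev)
    then show ?thesis by (intro exI[of _ "xs @ rev mid"]) simp
  qed
qed

text \<open>From position \<open>a\<close> run back to the end of the path, jump to its first
  neighbour beyond \<open>a\<close> and run on to \<open>s\<close>. The positions skipped in between
  carry no neighbour of that end. Here \<open>a\<close> and \<open>s\<close> are to be the places
  where two disjoint paths leave the initial segment.\<close>

lemma fan_path:
  assumes p: "path A W xs" and as: "a < s" "s < length xs" and adj: "A (hd xs) (xs ! s)"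
  shows "\<exists>ys. path A W ys \<and> hd ys = xs ! a \<and> last ys = xs ! s \<and> set ys \<subseteq> {xs ! i | i. i \<le> s} \<and>
    xs ! 0 \<in> set ys \<and> (\<forall>i\<le>s. A (hd xs) (xs ! i) \<longrightarrow> xs ! i \<in> set ys)"
proof -
  define q where "q = (LEAST q. a < q \<and> A (hd xs) (xs ! q))"
  have q: "a < q" "A (hd xs) (xs ! q)" "q \<le> s"
    using LeastI[of "\<lambda>q. a < q \<and> A (hd xs) (xs ! q)" s] Least_le[of "\<lambda>q. a < q \<and> A (hd xs) (xs ! q)" s]
      as adj by (auto simp: q_def)
  have q_min: "q \<le> i" if "a < i" "A (hd xs) (xs ! i)" for i
    using that by (auto simp: q_def intro: Least_le)
  let ?l = "rev (take (Suc a) xs)" and ?r = "drop q (take (Suc s) xs)"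
  let ?ys = "?l @ ?r"
  have sl: "set ?l = {xs ! i | i. i \<le> a}"
    using as by (auto simp: set_take_nth)
  have sr: "set ?r = {xs ! i | i. q \<le> i \<and> i \<le> s}"
    using as by (intro set_slice_nth) simp
  have hl: "hd ?l = xs ! a" using as by (simp add: hd_rev last_take_Suc)
  have ll: "last ?l = hd xs" using path_nonempty[OF p] by (simp add: last_rev)
  have hr: "hd ?r = xs ! q" using as q by (simp add: hd_drop_conv_nth)
  have lr: "last ?r = xs ! s" using as q by (simp add: last_take_Suc)
  have ne: "?l \<noteq> []" "?r \<noteq> []" using path_nonempty[OF p] as q by auto
  have "set ?l \<inter> set ?r = {}"
    using as q path_distinct[OF p] by (auto simp only: sl sr) (simp add: nth_eq_iff_index_eq)
  then have "path A W ?ys"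
    using as q hr ll p by (intro path_append path_rev path_take path_drop) auto
  moreover have "xs ! i \<in> set ?ys" if "i \<le> s" "A (hd xs) (xs ! i)" for i
    using q_min[of i] that sl sr by (cases "i \<le> a") auto
  moreover have "xs ! 0 \<in> set ?ys" using sl by auto
  moreover have "set ?ys \<subseteq> {xs ! i | i. i \<le> s}" using sl sr as by auto
  ultimately show ?thesis
    using hl lr ne by (intro exI[of _ ?ys]) auto
qed

text \<open>If no edges to the two ends cross, two disjoint paths joining the initial segment carrying
  the neighbours of one end to the final segment carrying those of the other close up to a cycle.\<close>

lemma noncrossing_cycle:
  assumes bi: "biconnected A W" and p: "path A W xs"
    and st: "0 < s" "s \<le> t" "Suc t < length xs"
    and as: "A (hd xs) (xs ! s)" and at: "A (last xs) (xs ! t)"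
    and N1: "\<And>i. i < length xs \<Longrightarrow> A (hd xs) (xs ! i) \<Longrightarrow> i \<le> s"
    and N2: "\<And>i. i < length xs \<Longrightarrow> A (last xs) (xs ! i) \<Longrightarrow> t \<le> i"
  shows "\<exists>zs. cycle A W zs \<and>
    card {i. i < length xs \<and> A (hd xs) (xs ! i)} + card {i. i < length xs \<and> A (last xs) (xs ! i)}
      \<le> length zs"
proof -
  let ?n = "length xs"
  have dist: "distinct xs" using path_distinct[OF p] .
  have inj: "i = j" if "i < ?n" "j < ?n" "xs ! i = xs ! j" for i j
    using that dist by (simp add: nth_eq_iff_index_eq)
  define S where "S = {xs ! i | i. i \<le> s}"
  define T where "T = {xs ! i | i. t \<le> i \<and> i < ?n}"
  let ?P = "drop s (take (Suc t) xs)"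
  have hP: "hd ?P = xs ! s" using st by (simp add: hd_drop_conv_nth)
  have lP: "last ?P = xs ! t" using st by (simp add: last_take_Suc)
  have sP: "set ?P = {xs ! i | i. s \<le> i \<and> i \<le> t}" using st by (intro set_slice_nth) simp
  have P: "path A W ?P" using p st by (intro path_drop path_take) auto
  have SW: "S \<subseteq> W" using p st path_nth by (fastforce simp: S_def)
  have TW: "T \<subseteq> W" using p st path_nth by (fastforce simp: T_def)
  have S2: "S - {w} \<noteq> {}" for w
  proof -
    have "{xs ! 0, xs ! s} \<subseteq> S" by (auto simp: S_def)
    moreover have "xs ! 0 \<noteq> xs ! s" using inj[of 0 s] st path_nonempty[OF p] by auto
    ultimately show ?thesis by auto
  qed
  have T2: "T - {w} \<noteq> {}" for w
  proof -
    have "{xs ! t, xs ! Suc t} \<subseteq> T" using st by (force simp: T_def)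
    moreover have "xs ! t \<noteq> xs ! Suc t" using inj[of t "Suc t"] st by auto
    ultimately show ?thesis by auto
  qed
  have PS: "set ?P \<inter> S = {hd ?P}"
  proof -
    have "v = xs ! s" if v: "v \<in> set ?P" "v \<in> S" for v
    proof -
      obtain i j where ij: "v = xs ! i" "s \<le> i" "i \<le> t" "v = xs ! j" "j \<le> s"
        using v unfolding sP S_def by blast
      then have "i = j" using st by (intro inj) auto
      then show ?thesis using ij by simp
    qed
    moreover have "xs ! s \<in> set ?P" "xs ! s \<in> S" unfolding sP S_def using st by blast+
    ultimately show ?thesis unfolding hP by blast
  qed
  have PT: "set ?P \<inter> T = {last ?P}"
  proof -
    have "v = xs ! t" if v: "v \<in> set ?P" "v \<in> T" for v
    proof -
      obtain i j where ij: "v = xs ! i" "s \<le> i" "i \<le> t" "v = xs ! j" "t \<le> j" "j < ?n"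
        using v unfolding sP T_def by blast
      then have "i = j" using st by (intro inj) auto
      then show ?thesis using ij by simp
    qed
    moreover have "xs ! t \<in> set ?P" unfolding sP using st by blast
    moreover have "xs ! t \<in> T" unfolding T_def using st by force
    ultimately show ?thesis unfolding lP by blast
  qed
  \<comment> \<open>Keeping the ends of the middle segment is essential: \<open>Q\<close> starts at
    \<open>xs ! s\<close> and one of the paths ends at \<open>xs ! t\<close>, and only a sweep that
    runs up to these extreme neighbours collects all of them.\<close>
  obtain Q R where Q: "path A W Q" and R: "path A W R" and QR: "set Q \<inter> set R = {}"
    and QS: "set Q \<inter> S = {hd Q}" and QT: "set Q \<inter> T = {last Q}"
    and RS: "set R \<inter> S = {hd R}" and RT: "set R \<inter> T = {last R}" and hQ: "hd Q = hd ?P"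
    and lQR: "last ?P \<in> {last Q, last R}"
    using two_disjoint_paths[OF bi TW T2 P SW S2 PS PT] by (elim exE conjE)
  have QSd: "v = hd Q" if "v \<in> set Q" "v \<in> S" for v using QS that by (metis IntI singletonD)
  have QTd: "v = last Q" if "v \<in> set Q" "v \<in> T" for v using QT that by (metis IntI singletonD)
  have RSd: "v = hd R" if "v \<in> set R" "v \<in> S" for v using RS that by (metis IntI singletonD)
  have RTd: "v = last R" if "v \<in> set R" "v \<in> T" for v using RT that by (metis IntI singletonD)
  have ne: "Q \<noteq> []" "R \<noteq> []" using Q R path_nonempty by auto
  have hlne: "hd Q \<noteq> hd R" "last Q \<noteq> last R"
    using QR hd_in_set[OF ne(1)] hd_in_set[OF ne(2)] last_in_set[OF ne(1)] last_in_set[OF ne(2)] by auto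
  have "hd R \<in> S" "last R \<in> T" "last Q \<in> T" using RS RT QT by blast+
  then obtain a b b' where a: "hd R = xs ! a" "a \<le> s" and b: "last R = xs ! b" "t \<le> b" "b < ?n"
    and b': "last Q = xs ! b'" "t \<le> b'" "b' < ?n"
    by (auto simp: S_def T_def)
  have a': "a < s" using a hlne hQ hP by (cases "a = s") auto
  obtain L where L: "path A W L" "hd L = xs ! a" "last L = xs ! s" "set L \<subseteq> S" "xs ! 0 \<in> set L"
    "\<forall>i\<le>s. A (hd xs) (xs ! i) \<longrightarrow> xs ! i \<in> set L"
    using fan_path[OF p a' _ as] st unfolding S_def by auto
  \<comment> \<open>The mirror image for \<open>T\<close>, obtained on \<open>rev xs\<close>, where
    position \<open>i\<close> becomes \<open>?n - Suc i\<close>.\<close>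
  have right: "\<exists>ys. path A W ys \<and> hd ys = xs ! c \<and> last ys = xs ! t \<and> set ys \<subseteq> T \<and>
    (\<forall>i<?n. A (last xs) (xs ! i) \<longrightarrow> xs ! i \<in> set ys)" if c: "t < c" "c < ?n" for c
  proof -
    have xr: "rev xs ! (?n - Suc i) = xs ! i" if "i < ?n" for i
      using that by (simp add: rev_nth Suc_diff_Suc)
    have h: "hd (rev xs) = last xs" by (simp add: hd_rev)
    have c1: "?n - Suc c < ?n - Suc t" "?n - Suc t < length (rev xs)"
        "A (hd (rev xs)) (rev xs ! (?n - Suc t))"
      using c st at xr[of t] h by auto
    obtain ys where ys: "path A W ys" "hd ys = rev xs ! (?n - Suc c)" "last ys = rev xs ! (?n - Suc t)"
      "set ys \<subseteq> {rev xs ! i | i. i \<le> ?n - Suc t}" "rev xs ! 0 \<in> set ys"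
      "\<forall>i\<le>?n - Suc t. A (last xs) (rev xs ! i) \<longrightarrow> rev xs ! i \<in> set ys"
      using fan_path[OF path_rev[OF p] c1] unfolding h by (elim exE conjE)
    have "set ys \<subseteq> T"
    proof
      fix v assume "v \<in> set ys"
      then obtain i where i: "v = rev xs ! i" "i \<le> ?n - Suc t" using ys(4) by auto
      then have "v = xs ! (?n - Suc i)" using st by (simp add: rev_nth)
      then show "v \<in> T" using i st by (auto simp: T_def intro!: exI[of _ "?n - Suc i"])
    qed
    moreover have "xs ! i \<in> set ys" if "i < ?n" "A (last xs) (xs ! i)" for i
      using ys(6)[rule_format, of "?n - Suc i"] that N2[of i] xr[of i] by auto
    ultimately show ?thesis using ys(1-3) xr c st by (intro exI[of _ ys]) auto
  qed
  have "\<exists>ys. path A W ys \<and> hd ys = last Q \<and> last ys = last R \<and> set ys \<subseteq> T \<and>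
    (\<forall>i<?n. A (last xs) (xs ! i) \<longrightarrow> xs ! i \<in> set ys)"
  proof (cases "last Q = xs ! t")
    case True
    then have "t < b" using b hlne by (cases "t = b") auto
    from right[OF this b(3)] obtain ys where "path A W ys" "hd ys = xs ! b" "last ys = xs ! t" "set ys \<subseteq> T"
      "\<forall>i<?n. A (last xs) (xs ! i) \<longrightarrow> xs ! i \<in> set ys" by blast
    then show ?thesis using True b path_rev[of W ys] path_nonempty[of A W ys]
      by (intro exI[of _ "rev ys"]) (auto simp: hd_rev last_rev)
  next
    case False
    then have "t < b'" "last R = xs ! t" using b' lQR lP by (cases "t = b'"; auto)+
    then show ?thesis using right[of b'] b' by metis
  qed
  then obtain M where M: "path A W M" "hd M = last Q" "last M = last R" "set M \<subseteq> T"
    "\<forall>i<?n. A (last xs) (xs ! i) \<longrightarrow> xs ! i \<in> set M" by blast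
  have Lne: "L \<noteq> []" "M \<noteq> []" using L(1) M(1) path_nonempty by auto
  have LT: "set L \<inter> T \<subseteq> {xs ! s}"
  proof
    fix v assume "v \<in> set L \<inter> T"
    then obtain i j where ij: "v = xs ! i" "i \<le> s" "v = xs ! j" "t \<le> j" "j < ?n"
      using L(4) unfolding S_def T_def by blast
    then have "i = j" using st by (intro inj) auto
    then have "i = s" using ij st by simp
    then show "v \<in> {xs ! s}" using ij by simp
  qed
  have hQs: "hd Q = xs ! s" using hQ hP by simp
  have LQ: "set L \<inter> set Q = {last L}"
  proof -
    have "set L \<inter> set Q \<subseteq> {xs ! s}" using L(4) QSd unfolding hQs by blast
    moreover have "xs ! s \<in> set L \<inter> set Q"
      using last_in_set[OF Lne(1)] hd_in_set[OF ne(1)] L(3) hQs by auto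
    ultimately show ?thesis using L(3) by auto
  qed
  let ?X = "L @ tl Q"
  have X: "path A W ?X" "hd ?X = hd L" "last ?X = last Q" "set ?X = set L \<union> set Q"
    using path_join[OF L(1) Q _ LQ] L(3) hQs by auto
  have XM: "set ?X \<inter> set M = {last ?X}"
  proof -
    have "set Q \<inter> set M \<subseteq> {last Q}" using M(4) QTd by blast
    moreover have "set L \<inter> set M \<subseteq> {last Q}"
    proof -
      have "set L \<inter> set M \<subseteq> {xs ! s}" using LT M(4) by blast
      moreover have "xs ! s = last Q" if "xs ! s \<in> set M"
      proof -
        have "xs ! s \<in> set Q" "xs ! s \<in> T" using that M(4) hd_in_set[OF ne(1)] hQs by auto
        then show ?thesis by (rule QTd)
      qed
      ultimately show ?thesis by blast
    qed
    moreover have "last Q \<in> set M" "last Q \<in> set Q"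
      using hd_in_set[OF Lne(2)] M(2) ne by auto
    ultimately show ?thesis unfolding X(3,4) by blast
  qed
  \<comment> \<open>\<open>L\<close>, \<open>Q\<close> and \<open>M\<close> glue to a path between
    the two ends of \<open>R\<close>, so \<open>R\<close> closes it to a cycle.\<close>
  let ?Y = "?X @ tl M"
  have Y: "path A W ?Y" "hd ?Y = hd L" "last ?Y = last R" "set ?Y = set L \<union> set Q \<union> set M"
    using path_join[OF X(1) M(1) _ XM] X M(2,3) by auto
  have x0: "hd xs = xs ! 0" using path_hd[OF p] .
  let ?I1 = "{i. i < ?n \<and> A (hd xs) (xs ! i)}" and ?I2 = "{i. i < ?n \<and> A (last xs) (xs ! i)}"
  \<comment> \<open>If \<open>s = t\<close>, this position is counted for both ends. Trading
    \<open>s\<close> for 0, which lies on the cycle and is not in \<open>?I1\<close>, makes the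
    index sets disjoint without changing the count.\<close>
  let ?I1' = "insert 0 (?I1 - {s})"
  have "card ?I1' = card ?I1"
  proof -
    have "s \<in> ?I1" "0 \<notin> ?I1" using st as x0 irrefl by auto
    moreover have "card ?I1 = Suc (card (?I1 - {s}))" using calculation card.remove[of ?I1 s] by simp
    moreover have "card ?I1' = Suc (card (?I1 - {s}))"
      using \<open>0 \<notin> ?I1\<close> by (intro card_insert_disjoint) auto
    ultimately show ?thesis by linarith
  qed
  moreover have disj: "?I1' \<inter> ?I2 = {}"
  proof -
    have "x < t" if "x \<in> ?I1'" for x
    proof (cases "x = 0")
      case False
      then have "x \<le> s" "x \<noteq> s" using that N1[of x] by auto
      then show ?thesis using st by simp
    qed (use st in simp)
    moreover have "t \<le> x" if "x \<in> ?I2" for x using that N2 by blast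
    ultimately show ?thesis by (meson disjoint_iff leD)
  qed
  moreover have "card ((!) xs ` (?I1' \<union> ?I2)) = card (?I1' \<union> ?I2)"
  proof (intro card_image inj_onI)
    fix x y assume xy: "x \<in> ?I1' \<union> ?I2" "y \<in> ?I1' \<union> ?I2" "xs ! x = xs ! y"
    have "x < ?n" "y < ?n" using xy(1,2) st by auto
    then show "x = y" using xy(3) by (rule inj)
  qed
  moreover have "(!) xs ` (?I1' \<union> ?I2) \<subseteq> set ?Y"
    using L(5,6) M(5) N1 unfolding Y(4) by auto
  moreover have "card (?I1' \<union> ?I2) = card ?I1' + card ?I2"
    using disj by (intro card_Un_disjoint) auto
  moreover have "card (set ?Y) = length ?Y" using path_distinct[OF Y(1)] by (rule distinct_card)
  ultimately have len: "card ?I1 + card ?I2 \<le> length ?Y"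
    using card_mono[OF List.finite_set, of "(!) xs ` (?I1' \<union> ?I2)" ?Y] by linarith
  have len3: "3 \<le> length ?Y"
  proof -
    have "card {xs ! 0, xs ! s, last R} = 3" if "last R \<noteq> xs ! s"
    proof -
      have "last R \<noteq> xs ! 0" "xs ! 0 \<noteq> xs ! s" using b st inj[of b 0] inj[of 0 s] path_nonempty[OF p] by auto
      then show ?thesis using that by auto
    qed
    moreover have "last R \<noteq> xs ! s"
      using QR last_in_set[OF ne(2)] hd_in_set[OF ne(1)] hQs by auto
    moreover have "{xs ! 0, xs ! s, last R} \<subseteq> set ?Y"
      using L(3,5) last_in_set[OF Lne(1)] last_in_set[OF Lne(2)] M(3) unfolding Y(4) by auto
    moreover have "card (set ?Y) = length ?Y" using path_distinct[OF Y(1)] by (rule distinct_card)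
    ultimately show ?thesis
      using card_mono[OF List.finite_set, of "{xs ! 0, xs ! s, last R}" ?Y] by linarith
  qed
  have "set ?Y \<inter> set R \<subseteq> {hd ?Y, last ?Y}"
  proof -
    have "set L \<inter> set R \<subseteq> {hd R}" using L(4) RSd by blast
    moreover have "set M \<inter> set R \<subseteq> {last R}" using M(4) RTd by blast
    ultimately show ?thesis using QR L(2) a(1) unfolding Y(2-4) by auto
  qed
  moreover have "hd ?Y \<noteq> last ?Y"
  proof
    assume "hd ?Y = last ?Y"
    then have "hd R = last R" using Y(2,3) L(2) a(1) by simp
    then have "xs ! a = xs ! b" using a b by simp
    then show False using inj[of a b] a' b st by auto
  qed
  ultimately have "\<exists>zs. cycle A W zs \<and> length ?Y \<le> length zs"
    using Y L(2) a(1) len3 by (intro two_paths_cycle[OF Y(1) R]) auto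
  then show ?thesis using len by (meson le_trans)
qed

text \<open>A crossing pair of edges with minimal span: neither end has a neighbour strictly inside the span,
  and the predecessors of the neighbours of one end are not neighbours of the other.\<close>

lemma long_cycle_of_path:
  assumes bi: "biconnected A W" and p: "path A W xs" and nadj: "\<not> A (hd xs) (last xs)"
    and I1: "I1 = {i. i < length xs \<and> A (hd xs) (xs ! i)}" "I1 \<noteq> {}"
    and I2: "I2 = {i. i < length xs \<and> A (last xs) (xs ! i)}" "I2 \<noteq> {}"
  shows "\<exists>zs. cycle A W zs \<and> min (length xs) (card I1 + card I2) \<le> length zs"
proof -
  let ?n = "length xs"
  have n: "0 < ?n" using path_length_pos[OF p] .
  have h: "hd xs = xs ! 0" and l: "last xs = xs ! (?n - 1)" using path_hd[OF p] path_last[OF p] by auto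
  have fin: "finite I1" "finite I2" using I1 I2 by auto
  have zero: "0 \<notin> I1" "0 \<notin> I2" using I1 I2 irrefl nadj sym h by auto
  have lst: "?n - 1 \<notin> I1" "?n - 1 \<notin> I2" using I1 I2 irrefl nadj l by auto
  have b1: "0 < i \<and> Suc i < ?n" if "i \<in> I1" for i
  proof -
    have "i < ?n" "i \<noteq> 0" "i \<noteq> ?n - 1" using that I1 zero lst by auto
    then show ?thesis by linarith
  qed
  have b2: "0 < i \<and> Suc i < ?n" if "i \<in> I2" for i
  proof -
    have "i < ?n" "i \<noteq> 0" "i \<noteq> ?n - 1" using that I2 zero lst by auto
    then show ?thesis by linarith
  qed
  show ?thesis
  proof (cases "\<exists>i\<in>I2. \<exists>j\<in>I1. i < j")
    case True
    then obtain i0 j0 where "i0 \<in> I2 \<and> j0 \<in> I1 \<and> i0 < j0" by blast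
    then have "\<exists>x. (\<lambda>(i, j). i \<in> I2 \<and> j \<in> I1 \<and> i < j) x \<and>
        (\<forall>y. (\<lambda>(i, j). i \<in> I2 \<and> j \<in> I1 \<and> i < j) y \<longrightarrow> (\<lambda>(i, j). j - i) x \<le> (\<lambda>(i, j). j - i) y)"
      by (intro ex_has_least_nat[of _ "(i0, j0)"]) auto
    then obtain i j where ij: "i \<in> I2" "j \<in> I1" "i < j"
      and min: "\<And>i' j'. i' \<in> I2 \<Longrightarrow> j' \<in> I1 \<Longrightarrow> i' < j' \<Longrightarrow> j - i \<le> j' - i'"
      by auto
    have "\<exists>zs. cycle A W zs \<and> length zs = Suc i + (?n - j)"
      using ij b1[OF ij(2)] b2[OF ij(1)] I1 I2 by (intro crossing_cycle[OF p]) auto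
    moreover have "min ?n (card I1 + card I2) \<le> Suc i + (?n - j)"
    proof (cases "j = Suc i")
      case True
      then show ?thesis using b1[OF ij(2)] by simp
    next
      case False
      \<comment> \<open>\<open>?U\<close> has exactly as many elements as the crossing cycle has
        vertices, so packing the shifted \<open>I1\<close> and \<open>I2\<close> into it is the
        required bound.\<close>
      let ?J = "(\<lambda>x. x - 1) ` I1" and ?U = "{..<?n - 1} - {Suc i..<j - 1}"
      have "card ?J = card I1"
      proof (intro card_image inj_onI)
        fix x y assume "x \<in> I1" "y \<in> I1" "x - 1 = y - 1"
        then show "x = y" using b1[of x] b1[of y] by linarith
      qed
      moreover have "card (?J \<union> I2) = card ?J + card I2"
      proof (rule card_Un_disjoint)
        show "?J \<inter> I2 = {}"
        proof -
          have False if "x \<in> I1" "x - 1 \<in> I2" for x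
            using min[OF that(2,1)] b1[OF that(1)] ij False by simp
          then show ?thesis by blast
        qed
      qed (use fin in auto)
      moreover have "card (?J \<union> I2) \<le> card ?U"
      proof (rule card_mono)
        have "x - 1 \<in> ?U" if "x \<in> I1" for x
        proof -
          have "\<not> (i < x \<and> x < j)" using min[OF ij(1) that] by auto
          then show ?thesis using b1[OF that] by auto
        qed
        moreover have "x \<in> ?U" if "x \<in> I2" for x
        proof -
          have "\<not> (i < x \<and> x < j)" using min[OF that ij(2)] by auto
          then show ?thesis using b2[OF that] by auto
        qed
        ultimately show "?J \<union> I2 \<subseteq> ?U" by blast
      qed simp
      moreover have "card ?U = Suc i + (?n - j)"
        using ij False b1[OF ij(2)] by (subst card_Diff_subset) auto
      ultimately show ?thesis by linarith
    qed
    ultimately show ?thesis by metis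
  next
    case False
    let ?s = "Max I1" and ?t = "Min I2"
    have s: "?s \<in> I1" and t: "?t \<in> I2" by (rule Max_in[OF fin(1) I1(2)], rule Min_in[OF fin(2) I2(2)])
    have "\<exists>zs. cycle A W zs \<and>
      card {i. i < length xs \<and> A (hd xs) (xs ! i)} + card {i. i < length xs \<and> A (last xs) (xs ! i)}
        \<le> length zs"
    proof (rule noncrossing_cycle[OF bi p])
      show "0 < ?s" "Suc ?t < ?n" using b1[OF s] b2[OF t] by auto
      show "?s \<le> ?t" using False s t by force
      show "A (hd xs) (xs ! ?s)" "A (last xs) (xs ! ?t)" using s t I1 I2 by auto
      show "i \<le> ?s" if "i < ?n" "A (hd xs) (xs ! i)" for i using that fin I1 by (intro Max_ge) auto
      show "?t \<le> i" if "i < ?n" "A (last xs) (xs ! i)" for i using that fin I2 by (intro Min_le) auto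
    qed
    then show ?thesis unfolding I1(1)[symmetric] I2(1)[symmetric] by (metis min.coboundedI2)
  qed
qed

end

section \<open>Cycles of every length from a Hamiltonian cycle\<close>

lemma deg_Un_disjoint:
  "finite X \<Longrightarrow> finite Y \<Longrightarrow> X \<inter> Y = {} \<Longrightarrow> deg A (X \<union> Y) v = deg A X v + deg A Y v"
proof -
  assume f: "finite X" "finite Y" and d: "X \<inter> Y = {}"
  have "{u \<in> X \<union> Y. A v u} = {u \<in> X. A v u} \<union> {u \<in> Y. A v u}" by auto
  then show ?thesis unfolding deg_def using f d by (simp add: card_Un_disjoint disjoint_iff)
qed

lemma deg_set: "distinct xs \<Longrightarrow> deg A (set xs) v = card {i. i < length xs \<and> A v (xs ! i)}"
  unfolding deg_def by (rule card_nth)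

lemma longest_path:
  assumes "finite W" "x \<in> W"
  obtains xs where "path A W xs" "\<And>ys. path A W ys \<Longrightarrow> length ys \<le> length xs"
proof -
  have "\<exists>xs. path A W xs \<and> (\<forall>ys. path A W ys \<longrightarrow> length ys \<le> length xs)"
    using path_single[OF assms(2)] path_length_le[OF _ assms(1)]
    by (intro ex_has_greatest_nat[where k = "[x]" and b = "Suc (card W)"]) (auto simp: less_Suc_eq_le le_SucI)
  then show ?thesis using that by blast
qed

text \<open>Bondy's pairing: a neighbour at position \<^term>\<open>a\<close> of the last vertex and a neighbour at the paired
  position of the first one yield a cycle of length \<^term>\<open>L\<close>.\<close>

definition bondy_pair :: "nat \<Rightarrow> nat \<Rightarrow> nat \<Rightarrow> nat" where
  "bondy_pair n L a = (if a + 3 \<le> L then a + n + 1 - L else a + 3 - L)"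

context sgraph begin

lemma bondy_pair_range:
  "3 \<le> L \<Longrightarrow> L \<le> n \<Longrightarrow> a \<in> {1..n-2} \<Longrightarrow> bondy_pair n L a \<in> {1..n-2}"
  by (auto simp: bondy_pair_def)

lemma bondy_pair_inj: "3 \<le> L \<Longrightarrow> L \<le> n \<Longrightarrow> inj_on (bondy_pair n L) {1..n-2}"
  by (auto simp: bondy_pair_def inj_on_def split: if_splits)

text \<open>For \<open>a + 3 \<le> L\<close> the partner lies beyond \<open>a\<close>, and the
  crossing cycle omits just the vertices between. Otherwise it lies at or before \<open>a\<close>:
  the stretch between the two has \<open>L - 2\<close> vertices and is closed through both ends of
  the list and the edge joining them.\<close>

lemma bondy_pair_cycle:
  assumes c: "cycle A W xs" and n: "length xs = n" and L: "3 \<le> L" "L \<le> n" and a: "a \<in> {1..n-2}"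
    and adj: "A (last xs) (xs ! a)" "A (hd xs) (xs ! bondy_pair n L a)"
  shows "\<exists>zs. cycle A W zs \<and> length zs = L"
proof -
  have p: "path A W xs" and n3: "3 \<le> n" and lh: "A (last xs) (hd xs)" using c n by (auto simp: cycle_def)
  show ?thesis
  proof (cases "a + 3 \<le> L")
    case True
    let ?b = "a + n + 1 - L"
    have "\<exists>zs. cycle A W zs \<and> length zs = Suc a + (length xs - ?b)"
      using True L a n adj by (intro crossing_cycle[OF p]) (auto simp: bondy_pair_def)
    moreover have "Suc a + (length xs - ?b) = L" using True L a n by simp
    ultimately show ?thesis by simp
  next
    case False
    let ?b = "a + 3 - L"
    have b: "1 \<le> ?b" "?b \<le> a" "Suc a < n" using False L a n3 by auto
    let ?m = "drop ?b (take (Suc a) xs)"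
    have h: "hd xs = xs ! 0" and l: "last xs = xs ! (n - 1)" using path_hd[OF p] path_last[OF p] n by auto
    have dist: "distinct xs" using path_distinct[OF p] .
    have sm: "set ?m = {xs ! i | i. ?b \<le> i \<and> i \<le> a}" using b n by (intro set_slice_nth) simp
    have m: "path A W ?m" using p b n by (intro path_drop path_take) auto
    have hm: "hd ?m = xs ! ?b" using b n by (simp add: hd_drop_conv_nth)
    have lm: "last ?m = xs ! a" using b n by (simp add: last_take_Suc)
    have mne: "?m \<noteq> []" using b n by simp
    have hnot: "hd xs \<notin> set ?m"
    proof
      assume "hd xs \<in> set ?m"
      then obtain i where i: "xs ! 0 = xs ! i" "?b \<le> i" "i \<le> a" unfolding sm h by blast
      then have "0 = i" using b n by (intro iffD1[OF nth_eq_iff_index_eq[OF dist] i(1)]) auto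
      then show False using i b by simp
    qed
    have lnot: "last xs \<notin> set (hd xs # ?m)"
    proof
      assume "last xs \<in> set (hd xs # ?m)"
      then obtain i where i: "xs ! (n - 1) = xs ! i" "i \<le> a" using sm h l by auto
      then have "n - 1 = i" using b n by (intro iffD1[OF nth_eq_iff_index_eq[OF dist] i(1)]) auto
      then show False using i b by simp
    qed
    have W: "hd xs \<in> W" "last xs \<in> W" using path_subset[OF p] path_nonempty[OF p] by auto
    have "path A W (hd xs # ?m)"
      using m W hnot adj(2) False hm by (intro path_Cons) (auto simp: bondy_pair_def)
    then have "path A W ((hd xs # ?m) @ [last xs])"
      using lnot W adj(1) lm mne sym by (intro path_append path_single) auto
    then have "cycle A W ((hd xs # ?m) @ [last xs])" using lh b n by (simp add: cycle_def)
    moreover have "length ((hd xs # ?m) @ [last xs]) = L" using b n False L by simp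
    ultimately show ?thesis by blast
  qed
qed

text \<open>The partners of \<open>X\<close> and the neighbours of the first vertex are disjoint
  sets of positions between 1 and n - 1. \<open>X\<close> is left free so that
  \<open>alternating_adjacency\<close> can add a position that is no neighbour of the last
  vertex.\<close>

lemma bondy_count:
  assumes c: "cycle A W xs" and n: "length xs = n" and L: "3 \<le> L" "L \<le> n"
    and I: "I = {i. i < n \<and> A (hd xs) (xs ! i)}" and X: "X \<subseteq> {1..n-2}"
    and no: "\<And>a. a \<in> X \<Longrightarrow> bondy_pair n L a \<notin> I"
  shows "card X + card I \<le> n - 1"
proof -
  have h: "hd xs = xs ! 0" using c by (auto simp: cycle_def path_hd)
  have "card (bondy_pair n L ` X) = card X"
    using inj_on_subset[OF bondy_pair_inj[OF L] X] by (rule card_image)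
  moreover have "card (bondy_pair n L ` X \<union> I) = card (bondy_pair n L ` X) + card I"
    using no I finite_subset[OF X] by (intro card_Un_disjoint) auto
  moreover have "bondy_pair n L ` X \<union> I \<subseteq> {1..n-1}"
  proof -
    have "bondy_pair n L a \<in> {1..n-1}" if "a \<in> X" for a
    proof -
      have "a \<in> {1..n-2}" using that X by blast
      from bondy_pair_range[OF L this] show ?thesis by auto
    qed
    moreover have "i \<in> {1..n-1}" if "i \<in> I" for i
      using that I h irrefl by (cases i) auto
    ultimately show ?thesis by blast
  qed
  then have "card (bondy_pair n L ` X \<union> I) \<le> n - 1"
    using card_mono[of "{1..n-1}"] by fastforce
  ultimately show ?thesis by simp
qed

text \<open>Position 0 is a neighbour of the last vertex through the cycle edge and has no partner.
  It accounts for the bound n instead of n - 1.\<close>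

lemma bondy_degree_sum:
  assumes c: "cycle A W xs" and L: "3 \<le> L" "L \<le> length xs"
    and no: "\<nexists>zs. cycle A W zs \<and> length zs = L"
  shows "deg A (set xs) (hd xs) + deg A (set xs) (last xs) \<le> length xs"
proof -
  let ?n = "length xs"
  have p: "path A W xs" using c by (rule cycle_path)
  have dist: "distinct xs" using path_distinct[OF p] .
  have l: "last xs = xs ! (?n - 1)" using path_last[OF p] .
  define I J where "I = {i. i < ?n \<and> A (hd xs) (xs ! i)}" and "J = {i. i < ?n \<and> A (last xs) (xs ! i)}"
  have fJ: "finite J" by (simp add: J_def)
  have "card (J - {0}) + card I \<le> ?n - 1"
  proof (rule bondy_count[OF c refl L I_def])
    have "?n - 1 \<notin> J" using l irrefl by (auto simp: J_def)
    then have r: "0 < i \<and> i \<le> ?n - 2" if "i \<in> J - {0}" for i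
    proof -
      have "i < ?n" "i \<noteq> ?n - 1" "i \<noteq> 0" using that \<open>?n - 1 \<notin> J\<close> by (auto simp: J_def)
      then show ?thesis by linarith
    qed
    show sub: "J - {0} \<subseteq> {1..?n-2}"
    proof
      fix i assume "i \<in> J - {0}"
      from r[OF this] show "i \<in> {1..?n-2}" by simp
    qed
    show "bondy_pair ?n L a \<notin> I" if "a \<in> J - {0}" for a
      using bondy_pair_cycle[OF c refl L] sub that no unfolding I_def J_def by blast
  qed
  moreover have "card J \<le> Suc (card (J - {0}))"
    using fJ card.remove[of J 0] by (cases "0 \<in> J") auto
  ultimately show ?thesis
    using L unfolding deg_set[OF dist] I_def[symmetric] J_def[symmetric] by linarith
qed

lemma sum_nth_distinct:
  fixes g :: "'a \<Rightarrow> nat"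
  assumes "distinct xs" shows "(\<Sum>i<length xs. g (xs ! i)) = (\<Sum>v\<in>set xs. g v)"
  using assms by (intro sum.reindex_bij_betw[OF bij_betw_nth]) auto

text \<open>If the length were missing, the degree sum along every edge of the cycle would be at
  most n. Each vertex lies on two of these n edges, so summing would bound twice the arcs by
  n^2.\<close>

lemma bondy_hamiltonian:
  assumes c: "cycle A W xs" and W: "W = set xs" and e: "length xs * length xs < 2 * arcs A W"
    and L: "3 \<le> L" "L \<le> length xs"
  shows "\<exists>zs. cycle A W zs \<and> length zs = L"
proof (rule ccontr)
  assume no: "\<nexists>zs. cycle A W zs \<and> length zs = L"
  let ?n = "length xs"
  have dist: "distinct xs" using c by (simp add: cycle_def path_def)
  have ne: "xs \<noteq> []" using c by (simp add: cycle_def path_def)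
  have "deg A W (rotate1 xs ! i) + deg A W (xs ! i) \<le> ?n" if "i < ?n" for i
  proof -
    let ?ys = "rotate (Suc i) xs"
    have "hd ?ys = rotate1 xs ! i"
      using that ne by (metis hd_rotate_conv_nth nth_rotate1)
    moreover have "last ?ys = hd (rotate i xs)"
      using ne by (cases "rotate i xs") auto
    then have "last ?ys = xs ! i" using that ne by (simp add: hd_rotate_conv_nth)
    moreover have "deg A (set ?ys) (hd ?ys) + deg A (set ?ys) (last ?ys) \<le> length ?ys"
      using cycle_rotate[OF c, of "Suc i"] L no by (intro bondy_degree_sum) auto
    ultimately show ?thesis using W by simp
  qed
  then have "(\<Sum>i<?n. deg A W (rotate1 xs ! i) + deg A W (xs ! i)) \<le> ?n * ?n"
    using sum_bounded_above[of "{..<?n}" _ ?n] by fastforce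
  moreover have "(\<Sum>i<?n. deg A W (xs ! i)) = arcs A W"
    using sum_nth_distinct[OF dist, of "deg A W"] W by (simp add: arcs_def)
  moreover have "(\<Sum>i<?n. deg A W (rotate1 xs ! i)) = arcs A W"
    using sum_nth_distinct[of "rotate1 xs" "deg A W"] W dist by (simp add: arcs_def)
  ultimately show False using e by (simp add: sum.distrib)
qed

section \<open>Vertices off a longest cycle\<close>

text \<open>Take a longest path off the cycle, with q vertices: each end has at most q - 1
  neighbours off the cycle. A neighbour of one end on the cycle forbids neighbours of the other in
  the next q positions, since the detour through the path would lengthen the cycle. So the degrees
  of the two ends add up to at most \<open>card W - 1\<close>. If an end has no neighbour on the
  cycle, its degree is small because the part off the cycle is not larger than the cycle.\<close>

lemma low_degree_off_longest_cycle:
  assumes fin: "finite W" and c0: "cycle A W cs0"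
    and longest: "\<And>zs. cycle A W zs \<Longrightarrow> length zs \<le> length cs0"
    and M: "W - set cs0 \<noteq> {}" "card (W - set cs0) \<le> length cs0"
  shows "\<exists>v\<in>W - set cs0. 2 * deg A W v \<le> card W - 1"
proof -
  define M where "M = W - set cs0"
  have fM: "finite M" using fin by (simp add: M_def)
  obtain x where "x \<in> M" using M(1) by (auto simp: M_def)
  then obtain us where us: "path A M us" and us_max: "\<And>ys. path A M ys \<Longrightarrow> length ys \<le> length us"
    using longest_path[OF fM] by metis
  define q where "q = length us"
  have dus: "distinct us" using path_distinct[OF us] .
  have une: "us \<noteq> []" using path_nonempty[OF us] .
  have q1: "1 \<le> q" using une by (cases us) (auto simp: q_def)
  have end_deg: "deg A M (hd ws) \<le> q - 1" if "path A M ws" "length ws = q" for ws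
  proof -
    have ne: "ws \<noteq> []" using path_nonempty[OF that(1)] .
    have "{w \<in> M. A (hd ws) w} \<subseteq> set ws - {hd ws}"
    proof
      fix w assume w: "w \<in> {w \<in> M. A (hd ws) w}"
      have "w \<in> set ws"
      proof (rule ccontr)
        assume "w \<notin> set ws"
        then have "path A M (w # ws)" using w that(1) sym by (intro path_Cons) auto
        then show False using us_max[of "w # ws"] that(2) by (simp add: q_def)
      qed
      then show "w \<in> set ws - {hd ws}" using w irrefl by auto
    qed
    then have "deg A M (hd ws) \<le> card (set ws - {hd ws})" unfolding deg_def by (intro card_mono) auto
    then show ?thesis using ne that(2) path_distinct[OF that(1)] by (simp add: distinct_card)
  qed
  define u v where "u = hd us" and "v = last us"
  have uM: "u \<in> M" "v \<in> M" using une path_subset[OF us] by (auto simp: u_def v_def)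
  have du: "deg A M u \<le> q - 1" using end_deg[OF us] by (simp add: q_def u_def)
  have dv: "deg A M v \<le> q - 1"
    using end_deg[OF path_rev[OF us]] une by (simp add: q_def v_def hd_rev)
  have degW: "deg A W w = deg A M w + deg A (set cs0) w" for w
  proof -
    have "W = M \<union> set cs0" using path_subset[OF cycle_path[OF c0]] by (auto simp: M_def)
    then show ?thesis using deg_Un_disjoint[of M "set cs0"] fM by (auto simp: M_def)
  qed
  have cardW: "card W = card M + length cs0"
  proof -
    have "card M = card W - card (set cs0)"
      unfolding M_def using path_subset[OF cycle_path[OF c0]] by (intro card_Diff_subset) auto
    moreover have "card (set cs0) = length cs0"
      using path_distinct[OF cycle_path[OF c0]] by (rule distinct_card)
    moreover have "length cs0 \<le> card W" using cycle_length_le[OF c0 fin] .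
    ultimately show ?thesis by simp
  qed
  have qM: "q \<le> card M" using path_length_le[OF us fM] by (simp add: q_def)
  show ?thesis
  proof (cases "\<exists>y\<in>set cs0. A v y")
    case False
    then have "deg A (set cs0) v = 0" by (simp add: deg_def)
    then have "2 * deg A W v \<le> card W - 1"
      using degW[of v] dv qM M(2) cardW q1 unfolding M_def[symmetric] by linarith
    then show ?thesis using uM by (auto simp: M_def)
  next
    case True
    then obtain y where y: "y \<in> set cs0" "A v y" by blast
    \<comment> \<open>Starting the cycle at a neighbour of \<open>v\<close> turns the cyclic order
      into a linear one: \<open>gap0\<close> shows that no forbidden stretch runs past the end of
      the list.\<close>
    obtain cs where cs: "cycle A W cs" "set cs = set cs0" "length cs = length cs0" "hd cs = y"
      using cycle_rotate_hd[OF c0 y(1)] by metis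
    define n where "n = length cs"
    have pc: "path A W cs" and n3: "3 \<le> n" using cs by (auto simp: cycle_def n_def)
    have dist: "distinct cs" using path_distinct[OF pc] .
    have usW: "path A W us" using us by (rule path_mono) (auto simp: M_def)
    have disj: "set cs \<inter> set us = {}" using path_subset[OF us] cs(2) by (auto simp: M_def)
    define I J where "I = {i. i < n \<and> A u (cs ! i)}" and "J = {i. i < n \<and> A v (cs ! i)}"
    have fI: "finite I" "finite J" by (auto simp: I_def J_def)
    have degI: "deg A (set cs0) u = card I" "deg A (set cs0) v = card J"
      using deg_set[OF dist] by (auto simp: I_def J_def n_def cs(2))
    have pre: "path A W (take (Suc s) cs @ us)" if "s \<in> I" for s
      using that pc usW disj sym set_take_subset[of "Suc s" cs]
      by (intro path_append path_take) (auto simp: I_def n_def last_take_Suc u_def)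
    have gap: "\<not> (s < t \<and> t \<le> s + q)" if "s \<in> I" "t \<in> J" for s t
    proof
      assume st: "s < t \<and> t \<le> s + q"
      have tn: "t < n" using that by (simp add: J_def)
      have "path A W ((take (Suc s) cs @ us) @ drop t cs)"
      proof (rule path_append[OF pre[OF that(1)]])
        show "path A W (drop t cs)" using pc tn by (intro path_drop) (simp_all add: n_def)
        have "set (take (Suc s) cs) \<inter> set (drop t cs) = {}"
          using dist st by (intro set_take_disj_set_drop_if_distinct) auto
        then show "set (take (Suc s) cs @ us) \<inter> set (drop t cs) = {}"
          using disj set_drop_subset[of t cs] by auto
        show "A (last (take (Suc s) cs @ us)) (hd (drop t cs))"
          using une that tn by (simp add: v_def J_def n_def hd_drop_conv_nth)
      qed
      moreover have "hd ((take (Suc s) cs @ us) @ drop t cs) = hd cs" using n3 by (cases cs) (auto simp: n_def)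
      moreover have "last ((take (Suc s) cs @ us) @ drop t cs) = last cs" using tn by (simp add: n_def)
      moreover have "length ((take (Suc s) cs @ us) @ drop t cs) = Suc s + q + (n - t)"
        using st tn by (simp add: n_def q_def)
      ultimately have "cycle A W ((take (Suc s) cs @ us) @ drop t cs)"
        using cs(1) q1 tn st by (auto simp: cycle_def)
      then have "Suc s + q + (n - t) \<le> n"
        using longest[of "(take (Suc s) cs @ us) @ drop t cs"] st tn cs(3) by (simp add: n_def q_def)
      then show False using st tn by linarith
    qed
    have gap0: "s + q < n" if "s \<in> I" for s
    proof (rule ccontr)
      assume no: "\<not> s + q < n"
      have "hd (take (Suc s) cs @ us) = hd cs" using n3 by (cases cs) (auto simp: n_def)
      moreover have len: "length (take (Suc s) cs @ us) = Suc s + q"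
        using that by (simp add: I_def n_def q_def)
      ultimately have "cycle A W (take (Suc s) cs @ us)"
        using pre[OF that] y(2) cs(4) une n3 no by (auto simp: cycle_def v_def)
      then show False using longest[of "take (Suc s) cs @ us"] len no cs(3) by (simp add: n_def)
    qed
    have "card I + (q - 1) + card J \<le> n" if "I \<noteq> {}"
    proof -
      \<comment> \<open>Every position of \<open>I\<close> forbids its successor to
        \<open>J\<close>, and the largest one forbids \<open>q - 1\<close> further positions, which
        no other successor occupies.\<close>
      define m where "m = Max I"
      have mI: "m \<in> I" and mmax: "\<And>s. s \<in> I \<Longrightarrow> s \<le> m" using that fI by (auto simp: m_def)
      have "card (Suc ` I) = card I" by (simp add: card_image)
      moreover have "card {m+2..m+q} = q - 1" by simp
      moreover have "card (Suc ` I \<union> {m+2..m+q}) = card (Suc ` I) + card {m+2..m+q}"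
        using fI by (intro card_Un_disjoint) (auto dest!: mmax)
      moreover have "card ((Suc ` I \<union> {m+2..m+q}) \<union> J) = card (Suc ` I \<union> {m+2..m+q}) + card J"
      proof (intro card_Un_disjoint)
        have False if "t \<in> J" "t \<in> Suc ` I" for t using gap[of "t - 1" t] that q1 by auto
        moreover have False if "t \<in> J" "t \<in> {m+2..m+q}" for t using gap[OF mI that(1)] that by auto
        ultimately show "(Suc ` I \<union> {m+2..m+q}) \<inter> J = {}" by blast
      qed (use fI in auto)
      moreover have "(Suc ` I \<union> {m+2..m+q}) \<union> J \<subseteq> {..<n}"
      proof -
        have "Suc s < n" if "s \<in> I" for s using gap0[OF that] q1 by linarith
        moreover have "t < n" if "t \<in> {m+2..m+q}" for t using gap0[OF mI] that by auto
        moreover have "t < n" if "t \<in> J" for t using that by (simp add: J_def)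
        ultimately show ?thesis by blast
      qed
      then have "card ((Suc ` I \<union> {m+2..m+q}) \<union> J) \<le> n"
        using card_mono[of "{..<n}"] by fastforce
      ultimately show ?thesis by linarith
    qed
    moreover have "card W = card M + n" using cardW cs(3) by (simp add: n_def)
    moreover have "card M \<le> n" using M(2) cs(3) by (simp add: n_def M_def)
    ultimately have "2 * deg A W u \<le> card W - 1 \<or> 2 * deg A W v \<le> card W - 1"
      using degW[of u] degW[of v] degI du dv qM q1 by (cases "I = {}") auto
    then show ?thesis using uM by (auto simp: M_def)
  qed
qed

text \<open>Deleting a vertex with \<open>2 * deg A W v \<le> card W - 1\<close> lowers the square
  of \<open>card W\<close> by \<open>2 * card W - 1\<close> and twice the arcs by at most
  \<open>2 * card W - 2\<close>, so the strict inequality survives until only the longest cycle is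
  left.\<close>

lemma weakly_pancyclic:
  assumes "finite W" "cycle A W cs" "\<And>zs. cycle A W zs \<Longrightarrow> length zs \<le> length cs"
    and "card W \<le> 2 * length cs" "card W * card W < 2 * arcs A W" "3 \<le> L" "L \<le> length cs"
  shows "\<exists>zs. cycle A W zs \<and> length zs = L"
  using assms
proof (induction "card W" arbitrary: W rule: less_induct)
  case less
  have sub: "set cs \<subseteq> W" using path_subset[OF cycle_path[OF less.prems(2)]] .
  have cardcs: "card (set cs) = length cs"
    using path_distinct[OF cycle_path[OF less.prems(2)]] by (rule distinct_card)
  show ?case
  proof (cases "W = set cs")
    case True
    then show ?thesis using less.prems cardcs by (intro bondy_hamiltonian[of W cs]) auto
  next
    case False
    have "card (W - set cs) \<le> length cs"
      using less.prems(1,4) sub cardcs by (simp add: card_Diff_subset)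
    then obtain v where v: "v \<in> W - set cs" "2 * deg A W v \<le> card W - 1"
      using low_degree_off_longest_cycle[OF less.prems(1-3)] False sub by blast
    let ?W = "W - {v}"
    obtain m where m: "card W = Suc m" "card ?W = m"
      using v less.prems(1) by (metis Diff_iff card.remove card_Suc_Diff1)
    have "arcs A W = arcs A ?W + 2 * deg A W v" using v less.prems(1) by (intro arcs_remove) auto
    then have "card ?W * card ?W < 2 * arcs A ?W"
      using less.prems(5) v(2) m by (simp add: algebra_simps)
    moreover have "cycle A ?W cs" using less.prems(2) v sub by (auto simp: cycle_def path_def)
    moreover have "length zs \<le> length cs" if "cycle A ?W zs" for zs
      using less.prems(3) cycle_mono[OF that] by blast
    ultimately have "\<exists>zs. cycle A ?W zs \<and> length zs = L"
      using less.prems m by (intro less.hyps) auto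
    then show ?thesis using cycle_mono[of A ?W _ W] by blast
  qed
qed

section \<open>Minimum degree at least half the order\<close>

text \<open>The neighbours of \<open>v\<close> occupy more than half of the cycle, so their
  positions meet their own shift by \<open>L - 2\<close>. The arc between two such neighbours has
  \<open>L - 1\<close> vertices, and \<open>v\<close> closes it.\<close>

lemma cycle_through_vertex:
  assumes c: "cycle A W zs" and v: "v \<in> W" "v \<notin> set zs" and d: "length zs < 2 * deg A (set zs) v"
    and L: "3 \<le> L" "L \<le> Suc (length zs)"
  shows "\<exists>ys. cycle A W ys \<and> length ys = L"
proof -
  let ?m = "length zs"
  define N where "N = {i. i < ?m \<and> A v (zs ! i)}"
  let ?f = "\<lambda>i. (i + (L - 2)) mod ?m"
  have m: "0 < ?m" using c by (auto simp: cycle_def)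
  have dist: "distinct zs" using path_distinct[OF cycle_path[OF c]] .
  have fN: "finite N" by (simp add: N_def)
  have cN: "?m < 2 * card N" using d deg_set[OF dist] by (simp add: N_def)
  have "inj_on ?f N"
  proof (rule inj_onI)
    fix i j assume ij: "i \<in> N" "j \<in> N" "?f i = ?f j"
    have *: "x = y" if "x \<le> y" "y < ?m" "?f y = ?f x" for x y
    proof -
      have "?m dvd y - x" using that mod_eq_dvd_iff_nat[of "x + (L - 2)" "y + (L - 2)" ?m] by simp
      then show ?thesis using that dvd_imp_le[of ?m "y - x"] by (cases "x = y") auto
    qed
    have lt: "i < ?m" "j < ?m" using ij(1,2) by (auto simp: N_def)
    show "i = j"
    proof (cases "i \<le> j")
      case True
      show ?thesis by (rule *[OF True lt(2) ij(3)[symmetric]])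
    next
      case False
      then have "j \<le> i" by simp
      then show ?thesis by (rule *[OF _ lt(1) ij(3), symmetric])
    qed
  qed
  then have "card (?f ` N) = card N" by (rule card_image)
  moreover have "card (?f ` N \<union> N) \<le> ?m"
  proof -
    have "?f ` N \<union> N \<subseteq> {..<?m}" using m by (auto simp: N_def)
    then show ?thesis using card_mono[of "{..<?m}"] by fastforce
  qed
  ultimately have "?f ` N \<inter> N \<noteq> {}"
    using card_Un_disjoint[of "?f ` N" N] fN cN by auto
  then obtain i where i: "i \<in> N" "?f i \<in> N" by auto
  let ?r = "rotate i zs"
  have r: "path A W ?r" using cycle_path[OF cycle_rotate[OF c]] .
  have hr: "hd (take (L - 1) ?r) = zs ! i"
    using m L i by (simp add: hd_rotate_conv_nth N_def)
  have "L - 1 = Suc (L - 2)" "L - 2 < ?m" using L by auto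
  then have lr: "last (take (L - 1) ?r) = zs ! ?f i"
    using last_take_Suc[of "L - 2" ?r] by (simp add: nth_rotate)
  have "path A W (v # take (L - 1) ?r)"
    using r L v hr i set_take_subset[of "L - 1" ?r]
    by (intro path_Cons path_take) (auto simp: N_def)
  moreover have len: "length (v # take (L - 1) ?r) = L" using L by simp
  moreover have "take (L - 1) ?r \<noteq> []" using m L by auto
  ultimately have "cycle A W (v # take (L - 1) ?r)"
    using L i lr sym by (simp add: cycle_def N_def)
  then show ?thesis using len by blast
qed

text \<open>Without a cycle of length one less than Hamiltonian, equality must hold in Bondy's counting around
  every edge of the cycle, which makes the graph complete bipartite along the cycle.\<close>

lemma alternating_adjacency:
  assumes even: "even n" and n4: "4 \<le> n" and min_deg: "\<And>v. v \<in> W \<Longrightarrow> n \<le> 2 * deg A W v"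
    and no: "\<nexists>zs. cycle A W zs \<and> length zs = n - 1"
    and d: "1 \<le> d" "d < n"
    and c: "cycle A W zs" "set zs = W" "length zs = n"
  shows "A (hd zs) (zs ! d) \<longleftrightarrow> odd d"
  using d c
proof (induction d arbitrary: zs rule: dec_induct)
  case base
  then show ?case
    using n4 path_step[of A W zs 0] path_hd[of A W zs] by (auto simp: cycle_def)
next
  case (step d)
  note c = step.prems(2) and sW = step.prems(3) and len = step.prems(4)
  have p: "path A W zs" using c by (rule cycle_path)
  have dist: "distinct zs" using path_distinct[OF p] .
  \<comment> \<open>Rotating by \<open>n - 1\<close> puts the last vertex in front, so the induction
    hypothesis decides whether the last vertex sees \<open>zs ! (d - 1)\<close>.\<close>
  let ?y = "rotate (n - 1) zs"
  have ne: "zs \<noteq> []" using path_nonempty[OF p] .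
  have l: "last zs = zs ! (n - 1)" using path_last[OF p] len by simp
  have h: "hd zs = zs ! 0" using path_hd[OF p] .
  have hy: "hd ?y = last zs" using n4 len l ne by (simp add: hd_rotate_conv_nth)
  have "?y ! d = zs ! ((n - 1 + d) mod n)" using step.prems len by (simp add: nth_rotate)
  moreover have "(n - 1 + d) mod n = d - 1"
  proof -
    have "n - 1 + d = n + (d - 1)" and lt: "d - 1 < n"
      using step.hyps(1) step.prems(1) n4 by linarith+
    then show ?thesis by (simp only: mod_add_self1 mod_less[OF lt])
  qed
  ultimately have yd: "?y ! d = zs ! (d - 1)" by simp
  have IH: "A (last zs) (zs ! (d - 1)) \<longleftrightarrow> odd d"
  proof -
    have "d < n" "set ?y = W" "length ?y = n" using step.prems(1) sW len by simp_all
    from step.IH[OF this(1) cycle_rotate[OF c] this(2,3)] show ?thesis unfolding hy yd .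
  qed
  show ?case
  proof (cases "odd d")
    case True
    \<comment> \<open>The edge would cross the one from the last vertex to
      \<open>zs ! (d - 1)\<close>, and the resulting cycle would skip only
      \<open>zs ! d\<close>.\<close>
    have "\<not> A (hd zs) (zs ! Suc d)"
    proof
      assume "A (hd zs) (zs ! Suc d)"
      then have "\<exists>ys. cycle A W ys \<and> length ys = Suc (d - 1) + (length zs - Suc d)"
        using step.prems(1) step.hyps len n4 IH True by (intro crossing_cycle[OF p]) auto
      moreover have "Suc (d - 1) + (length zs - Suc d) = n - 1"
        using step.prems(1) step.hyps len by simp
      ultimately show False using no by metis
    qed
    then show ?thesis using True by simp
  next
    case False
    have "A (hd zs) (zs ! Suc d)"
    proof (cases "Suc d = n - 1")
      case True
      then show ?thesis using c l sym by (simp add: cycle_def)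
    next
      case last: False
      show ?thesis
      proof (rule ccontr)
        assume nadj: "\<not> A (hd zs) (zs ! Suc d)"
        define I J where "I = {i. i < n \<and> A (hd zs) (zs ! i)}" and "J = {i. i < n \<and> A (last zs) (zs ! i)}"
        have fJ: "finite J" by (simp add: J_def)
        have d1: "1 \<le> d - 1" "d \<le> n - 3" using step.hyps False last step.prems(1) n4 even by (auto elim!: evenE)
        have dJ: "d - 1 \<notin> J" using IH False by (simp add: J_def)
        have nJ: "n - 1 \<notin> J" using irrefl l by (simp add: J_def)
        have sub: "J - {0} \<subseteq> {1..n-2}"
        proof
          fix i assume "i \<in> J - {0}"
          then have "i < n" "i \<noteq> n - 1" "i \<noteq> 0" using nJ by (auto simp: J_def)
          then show "i \<in> {1..n-2}" by simp
        qed
        \<comment> \<open>Position \<open>d - 1\<close> is no neighbour of the last vertex, and its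
          partner \<open>Suc d\<close> is no neighbour of the first. Counting it too makes up for
          position 0 and pushes the degree sum down to \<open>n - 1\<close>, against the minimum
          degree.\<close>
        have "card (insert (d - 1) (J - {0})) + card I \<le> n - 1"
        proof (rule bondy_count[OF c len _ _ I_def])
          show "3 \<le> n - 1" "n - 1 \<le> n" using n4 by auto
          show "insert (d - 1) (J - {0}) \<subseteq> {1..n-2}" using sub d1 by auto
          fix a assume a: "a \<in> insert (d - 1) (J - {0})"
          show "bondy_pair n (n - 1) a \<notin> I"
          proof (cases "a = d - 1")
            case True
            have "a + 3 \<le> n - 1" "a + n + 1 - (n - 1) = Suc d" using d1 n4 True by linarith+
            then have "bondy_pair n (n - 1) a = Suc d" by (simp only: bondy_pair_def if_True)
            then show ?thesis using nadj by (simp add: I_def)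
          next
            case False
            then have aJ: "a \<in> J" "a \<in> {1..n-2}" using a sub by auto
            have "3 \<le> n - 1" "n - 1 \<le> n" using n4 by auto
            from bondy_pair_cycle[OF c len this aJ(2)] show ?thesis
              using aJ(1) no unfolding I_def J_def by blast
          qed
        qed
        moreover have "card J = Suc (card (J - {0}))"
        proof -
          have "0 \<in> J" using c n4 h by (auto simp: J_def cycle_def)
          then show ?thesis by (rule card.remove[OF fJ])
        qed
        moreover have "card (insert (d - 1) (J - {0})) = Suc (card (J - {0}))"
          using dJ fJ by simp
        moreover have "n \<le> 2 * card I" "n \<le> 2 * card J"
          using min_deg[of "hd zs"] min_deg[of "last zs"] ne sW deg_set[OF dist, of A] len
          by (auto simp: I_def J_def)
        ultimately show False using n4 by linarith
      qed
    qed
    then show ?thesis using False by simp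
  qed
qed

text \<open>A vertex missed by a cycle of length n - 1 has at least n/2 neighbours on it, just
  enough for \<open>cycle_through_vertex\<close>. Without such a cycle, the chord from the first
  vertex to the odd position \<open>L - 1\<close> closes an initial piece of the Hamiltonian
  cycle.\<close>

lemma even_cycles_of_min_degree:
  assumes c: "cycle A W xs" and W: "set xs = W" "length xs = n" and even: "even n"
    and min_deg: "\<And>v. v \<in> W \<Longrightarrow> n \<le> 2 * deg A W v" and L: "even L" "4 \<le> L" "L \<le> n"
  shows "\<exists>zs. cycle A W zs \<and> length zs = L"
proof (cases "\<exists>zs. cycle A W zs \<and> length zs = n - 1")
  case True
  then obtain zs where zs: "cycle A W zs" "length zs = n - 1" by blast
  have fin: "finite W" using W by auto
  have cardW: "card W = n" using path_distinct[OF cycle_path[OF c]] W by (metis distinct_card)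
  have sub: "set zs \<subseteq> W" using path_subset[OF cycle_path[OF zs(1)]] .
  have "card (set zs) = n - 1" using path_distinct[OF cycle_path[OF zs(1)]] zs(2) by (simp add: distinct_card)
  then have "card (W - set zs) = 1" using sub cardW L by (simp add: card_Diff_subset)
  then obtain v where "W - set zs = {v}" by (rule card_1_singletonE)
  then have v: "v \<in> W" "v \<notin> set zs" "W - {v} = set zs" using sub by auto
  have "deg A (set zs) v = deg A W v" using deg_remove_self[of W v] v(3) by simp
  then have lt: "length zs < 2 * deg A (set zs) v" using min_deg[OF v(1)] zs(2) L by linarith
  show ?thesis by (rule cycle_through_vertex[OF zs(1) v(1,2) lt]) (use L zs(2) in auto)
next
  case False
  have p: "path A W xs" using c by (rule cycle_path)
  have "A (hd xs) (xs ! (L - 1))"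
  proof -
    have "4 \<le> n" "1 \<le> L - 1" "L - 1 < n" "odd (L - 1)" using L by auto
    then show ?thesis using alternating_adjacency[OF even _ min_deg False _ _ c W, of "L - 1"] by blast
  qed
  moreover have "last (take L xs) = xs ! (L - 1)"
    using last_take_Suc[of "L - 1" xs] L W by simp
  moreover have "hd (take L xs) = hd xs" using L by (cases xs) auto
  ultimately have "cycle A W (take L xs)" using p L W sym by (auto simp: cycle_def intro: path_take)
  then show ?thesis using L W by (intro exI[of _ "take L xs"]) simp
qed

end

section \<open>Circumference of dense biconnected graphs\<close>

text \<open>Right minus left is d(d - 1) + 2k with d = j - k, and d(d - 1) is never negative for
  integers.\<close>

lemma degenerate_count:
  fixes j k :: nat
  assumes "1 \<le> k" "1 \<le> j"
  shows "(k + 1) * k + 2 * k * (k + j - 1) < (2 * k + 1) * (2 * k) + j * (j - 1)"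
proof -
  obtain i where i: "j = Suc i" using assms(2) by (cases j) auto
  show ?thesis
  proof (cases "k \<le> i")
    case True
    then obtain m where "i = k + m" using le_Suc_ex by blast
    then show ?thesis using assms(1) by (simp add: i algebra_simps)
  next
    case False
    then obtain m where "k = i + m" using le_Suc_ex[of i k] by auto
    then show ?thesis using assms(1) by (cases m) (simp_all add: i algebra_simps)
  qed
qed

text \<open>The left side is a clique on \<open>2 * k + 2 - a\<close> vertices plus
  \<open>j + a - 2\<close> vertices peeled off with degree at most \<open>a\<close>. Right minus
  left is 4(k - a)(a - 1) + (a - j)^2 + 3a - j - 2, positive by 2 \<le> j \<le> a \<le> k.\<close>

lemma clique_count:
  fixes a j k :: nat
  assumes "2 \<le> j" "j \<le> a" "a \<le> k"
  shows "(2 * k + 2 - a) * (2 * k + 1 - a) + 2 * a * (j + a - 2) < (2 * k + 1) * (2 * k) + j * (j - 1)"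
proof -
  obtain i where i: "j = i + 2" using assms(1) by (metis add.commute le_Suc_ex)
  obtain p where p: "a = i + 2 + p" using assms(2) i le_Suc_ex by blast
  obtain q where q: "k = i + 2 + p + q" using assms(3) p le_Suc_ex by blast
  have "2 * k + 2 - a = i + p + 2 * q + 4" "2 * k + 1 - a = i + p + 2 * q + 3" "j + a - 2 = 2 * i + p + 2"
    "j - 1 = i + 1"
    using i p q by auto
  then show ?thesis by (simp add: i p q algebra_simps)
qed

context sgraph begin

text \<open>A longest path joining a non-adjacent pair of the given kind contains all relevant neighbours of its
  ends: a neighbour off the path extends it to another such pair or closes it to a long cycle.\<close>

lemma nonadjacent_pair_long_cycle:
  assumes fin: "finite W" and bi: "biconnected A W"
    and far: "\<And>x y. x \<in> W \<Longrightarrow> y \<in> W \<Longrightarrow> x \<noteq> y \<Longrightarrow> \<not> A x y \<Longrightarrow>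
      \<exists>xs. path A W xs \<and> hd xs = x \<and> last xs = y \<and> K \<le> length xs"
    and sub: "U1 \<subseteq> W" "Z1 \<subseteq> W" "U2 \<subseteq> W"
    and pair: "x0 \<in> U1" "y0 \<in> U2" "x0 \<noteq> y0" "\<not> A x0 y0"
    and d1: "\<And>x. x \<in> U1 \<Longrightarrow> d1 \<le> deg A Z1 x" "1 \<le> d1"
    and d2: "\<And>y. y \<in> U2 \<Longrightarrow> d2 \<le> deg A U2 y" "1 \<le> d2"
    and K: "K \<le> d1 + d2" "2 \<le> K"
    and Z1: "\<And>x y. x \<in> Z1 \<Longrightarrow> x \<notin> U1 \<Longrightarrow> y \<in> U2 \<Longrightarrow> y \<noteq> x \<Longrightarrow> A x y"
  shows "\<exists>zs. cycle A W zs \<and> K \<le> length zs"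
proof -
  \<comment> \<open>The ends range over \<open>U1\<close> and \<open>U2\<close>, while their degrees
    are counted in \<open>Z1\<close> and \<open>U2\<close>. The asymmetry serves the use with
    \<open>U1 = S - H\<close> and \<open>Z1 = S\<close>, where a neighbour in the clique
    \<open>H\<close> is no admissible end but sees the opposite end.\<close>
  define P where "P xs \<longleftrightarrow> path A W xs \<and> hd xs \<in> U1 \<and> last xs \<in> U2 \<and> hd xs \<noteq> last xs \<and>
    \<not> A (hd xs) (last xs)" for xs
  have far': "\<exists>xs. P xs \<and> hd xs = x \<and> last xs = y \<and> K \<le> length xs"
    if "x \<in> U1" "y \<in> U2" "x \<noteq> y" "\<not> A x y" for x y
    using far[of x y] that sub unfolding P_def by blast
  obtain xs0 where xs0: "P xs0" using far'[OF pair] by blast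
  have bound: "\<forall>ys. P ys \<longrightarrow> length ys < Suc (card W)"
    using path_length_le[OF _ fin] by (auto simp: P_def less_Suc_eq_le)
  obtain xs where xs: "P xs" and xs_max: "\<And>ys. P ys \<Longrightarrow> length ys \<le> length xs"
    using ex_has_greatest_nat[of P, OF xs0 bound] by blast
  let ?x = "hd xs" and ?y = "last xs"
  have p: "path A W xs" and xU: "?x \<in> U1" and yU: "?y \<in> U2" and xy: "?x \<noteq> ?y" "\<not> A ?x ?y"
    using xs by (auto simp: P_def)
  have long: "K \<le> length xs" using far'[OF xU yU xy] xs_max order_trans by blast
  have ne: "xs \<noteq> []" using path_nonempty[OF p] .
  have dist: "distinct xs" using path_distinct[OF p] .
  have in_xs: "?x \<in> set xs" "?y \<in> set xs" using ne by auto
  show ?thesis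
  proof (rule ccontr)
    assume no: "\<not> ?thesis"
    have x_nbr: "u \<in> set xs" if u: "u \<in> Z1" "A ?x u" for u
    proof (rule ccontr)
      assume out: "u \<notin> set xs"
      have q: "path A W (u # xs)" using p out u sub sym by (intro path_Cons) auto
      have uy: "u \<noteq> ?y" using out in_xs by auto
      show False
      proof (cases "A u ?y")
        case True
        then have "cycle A W (u # xs)" using q long K ne sym by (auto simp: cycle_def)
        then show False using no long by (metis length_Cons le_SucI)
      next
        case False
        then have "u \<in> U1" using Z1[OF u(1) _ yU] uy by blast
        then have "P (u # xs)" using q yU uy False ne by (simp add: P_def)
        then show False using xs_max[of "u # xs"] by simp
      qed
    qed
    have y_nbr: "u \<in> set xs" if u: "u \<in> U2" "A ?y u" for u
    proof (rule ccontr)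
      assume out: "u \<notin> set xs"
      have q: "path A W (xs @ [u])" using p out u sub by (intro path_append path_single) auto
      have ux: "?x \<noteq> u" using out in_xs by auto
      show False
      proof (cases "A u ?x")
        case True
        then have "cycle A W (xs @ [u])" using q long K ne by (auto simp: cycle_def)
        then show False using no long by (metis length_append_singleton le_SucI)
      next
        case False
        then have "P (xs @ [u])" using q xU u ux ne sym by (auto simp: P_def)
        then show False using xs_max[of "xs @ [u]"] by simp
      qed
    qed
    define I J where "I = {i. i < length xs \<and> A ?x (xs ! i)}" and "J = {i. i < length xs \<and> A ?y (xs ! i)}"
    have "deg A Z1 ?x \<le> deg A (set xs) ?x"
      unfolding deg_def using x_nbr by (intro card_mono) auto
    then have I: "d1 \<le> card I" using d1(1)[OF xU] deg_set[OF dist, of A ?x] by (simp add: I_def)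
    have "deg A U2 ?y \<le> deg A (set xs) ?y"
      unfolding deg_def using y_nbr by (intro card_mono) auto
    then have J: "d2 \<le> card J" using d2(1)[OF yU] deg_set[OF dist, of A ?y] by (simp add: J_def)
    have "I \<noteq> {}" "J \<noteq> {}" using I J d1(2) d2(2) by auto
    then have "\<exists>zs. cycle A W zs \<and> min (length xs) (card I + card J) \<le> length zs"
      by (intro long_cycle_of_path[OF bi p xy(2) I_def _ J_def])
    then obtain zs where zs: "cycle A W zs" "min (length xs) (card I + card J) \<le> length zs" by blast
    have "K \<le> length zs" using zs(2) long I J K by linarith
    then show False using no zs(1) by blast
  qed
qed

text \<open>By hypothesis every set strictly above \<open>H\<close> still has a vertex of small
  degree outside \<open>H\<close>, so the peeling never gets stuck before \<open>H\<close>.\<close>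

lemma arcs_peel:
  assumes "finite W" "H \<subseteq> W"
    and "\<And>S. H \<subset> S \<Longrightarrow> S \<subseteq> W \<Longrightarrow> \<exists>x\<in>S - H. deg A S x \<le> a"
  shows "arcs A W \<le> arcs A H + 2 * a * card (W - H)"
  using assms
proof (induction "card (W - H)" arbitrary: W)
  case 0
  then have "W = H" by auto
  then show ?case by simp
next
  case (Suc m)
  then have "H \<subset> W" by auto
  then obtain x where x: "x \<in> W - H" "deg A W x \<le> a" using Suc.prems(3)[of W] by blast
  have eq: "W - {x} - H = (W - H) - {x}" by auto
  then have c: "card (W - {x} - H) = m" using x Suc.hyps(2) Suc.prems(1) by simp
  have "arcs A (W - {x}) \<le> arcs A H + 2 * a * card (W - {x} - H)"
    using Suc.prems x c by (intro Suc.hyps(1)) auto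
  moreover have "arcs A W = arcs A (W - {x}) + 2 * deg A W x"
    using x Suc.prems(1) by (intro arcs_remove) auto
  moreover have "card (W - H) = Suc (card (W - {x} - H))" using c Suc.hyps(2) by simp
  ultimately show ?case using x(2) by (simp add: algebra_simps)
qed

text \<open>Peeling stops at \<open>a + 1\<close> vertices, which are bounded as a clique; this is
  better than charging \<open>a\<close> for each of them.\<close>

lemma arcs_degenerate:
  assumes "finite W" and "\<And>S. S \<noteq> {} \<Longrightarrow> S \<subseteq> W \<Longrightarrow> \<exists>x\<in>S. deg A S x \<le> a" and "card W = a + 1 + m"
  shows "arcs A W \<le> (a + 1) * a + 2 * a * m"
  using assms
proof (induction m arbitrary: W)
  case 0
  then show ?case using arcs_le[of W] by simp
next
  case (Suc m)
  then have "W \<noteq> {}" by auto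
  then obtain x where x: "x \<in> W" "deg A W x \<le> a" using Suc.prems(2)[of W] by blast
  have "arcs A (W - {x}) \<le> (a + 1) * a + 2 * a * m"
    using Suc.prems x by (intro Suc.IH) auto
  moreover have "arcs A W = arcs A (W - {x}) + 2 * deg A W x"
    using x Suc.prems(1) by (intro arcs_remove) auto
  ultimately show ?case using x(2) by (simp add: algebra_simps)
qed

lemma complete_path:
  assumes "\<And>x y. x \<in> set xs \<Longrightarrow> y \<in> set xs \<Longrightarrow> x \<noteq> y \<Longrightarrow> A x y" and "distinct xs" "xs \<noteq> []" "set xs \<subseteq> W"
  shows "path A W xs"
  using assms by (auto simp: path_def successively_conv_nth nth_eq_iff_index_eq)

lemma complete_cycle:
  assumes "\<And>x y. x \<in> set xs \<Longrightarrow> y \<in> set xs \<Longrightarrow> x \<noteq> y \<Longrightarrow> A x y" and "distinct xs" "3 \<le> length xs"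
    and "set xs \<subseteq> W"
  shows "cycle A W xs"
proof -
  have ne: "xs \<noteq> []" using assms(3) by auto
  have "last xs \<noteq> hd xs"
    using assms(2,3) ne by (auto simp: hd_conv_nth last_conv_nth nth_eq_iff_index_eq)
  then have "A (last xs) (hd xs)" using ne by (intro assms(1)) auto
  then show ?thesis using complete_path[OF assms(1,2) ne assms(4)] assms(3) by (auto simp: cycle_def)
qed

text \<open>\<open>far\<close> is what edge-maximality provides. A largest set \<open>H\<close> of
  induced minimum degree at least k + 1 exists by the count for degenerate graphs. It is a clique,
  since a non-adjacent pair in it has degree sum 2k + 2, and it has at most 2k + 1 vertices, since
  it is Hamiltonian. If \<open>W\<close> could not be peeled down to \<open>H\<close> at degree
  \<open>a\<close>, a vertex outside \<open>H\<close> and one in \<open>H\<close> would form another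
  pair with degree sum 2k + 2. So peeling works, and it leaves too few arcs.\<close>

lemma edge_maximal_long_cycle:
  assumes fin: "finite W" and bi: "biconnected A W" and card: "card W = 2 * k + j"
    and k: "1 \<le> k" and j: "2 \<le> j" and min_deg: "\<And>v. v \<in> W \<Longrightarrow> j \<le> deg A W v"
    and e: "(2 * k + 1) * (2 * k) + j * (j - 1) \<le> arcs A W"
    and far: "\<And>x y. x \<in> W \<Longrightarrow> y \<in> W \<Longrightarrow> x \<noteq> y \<Longrightarrow> \<not> A x y \<Longrightarrow>
      \<exists>xs. path A W xs \<and> hd xs = x \<and> last xs = y \<and> 2 * k + 2 \<le> length xs"
  shows "\<exists>zs. cycle A W zs \<and> 2 * k + 2 \<le> length zs"
proof (rule ccontr)
  assume no: "\<not> ?thesis"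
  define F where "F S \<longleftrightarrow> S \<subseteq> W \<and> S \<noteq> {} \<and> (\<forall>x\<in>S. k + 1 \<le> deg A S x)" for S
  have exF: "\<exists>S. F S"
  proof (rule ccontr)
    assume nF: "\<nexists>S. F S"
    have "\<exists>x\<in>S. deg A S x \<le> k" if "S \<noteq> {}" "S \<subseteq> W" for S
    proof (rule ccontr)
      assume "\<not> (\<exists>x\<in>S. deg A S x \<le> k)"
      then have "F S" using that by (auto simp: F_def not_le)
      then show False using nF by blast
    qed
    then have "arcs A W \<le> (k + 1) * k + 2 * k * (k + j - 1)"
      using card k by (intro arcs_degenerate[OF fin]) auto
    then show False using degenerate_count[OF k, of j] j e by simp
  qed
  then obtain H where H: "F H" and H_max: "\<And>S. F S \<Longrightarrow> card S \<le> card H"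
  proof -
    obtain S0 where "F S0" using exF by blast
    moreover have "\<forall>S. F S \<longrightarrow> card S < Suc (card W)"
      using card_mono[OF fin] by (auto simp: F_def less_Suc_eq_le)
    ultimately show ?thesis using that ex_has_greatest_nat[of F S0 card "Suc (card W)"] by blast
  qed
  have HW: "H \<subseteq> W" and Hne: "H \<noteq> {}" and Hdeg: "\<And>x. x \<in> H \<Longrightarrow> k + 1 \<le> deg A H x"
    using H by (auto simp: F_def)
  have fH: "finite H" using HW fin finite_subset by blast
  have complete: "A x y" if "x \<in> H" "y \<in> H" "x \<noteq> y" for x y
  proof (rule ccontr)
    assume "\<not> A x y"
    then have "\<exists>zs. cycle A W zs \<and> 2 * k + 2 \<le> length zs"
      using nonadjacent_pair_long_cycle[OF fin bi far HW HW HW that _ Hdeg _ Hdeg] by simp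
    then show False using no by blast
  qed
  have degH: "deg A H y = card H - 1" if "y \<in> H" for y
  proof -
    have "{u \<in> H. A y u} = H - {y}" using complete that irrefl by auto
    then show ?thesis using that fH by (simp add: deg_def)
  qed
  have h1: "k + 2 \<le> card H"
  proof -
    obtain y where y: "y \<in> H" using Hne by blast
    show ?thesis using Hdeg[OF y] degH[OF y] by linarith
  qed
  have h2: "card H \<le> 2 * k + 1"
  proof (rule ccontr)
    assume "\<not> ?thesis"
    obtain hs where hs: "set hs = H" "distinct hs" using finite_distinct_list[OF fH] by blast
    then have len: "length hs = card H" using distinct_card by metis
    have "cycle A W hs" using hs HW len h1 k complete by (intro complete_cycle) auto
    then show False using no len \<open>\<not> card H \<le> 2 * k + 1\<close> by auto
  qed
  \<comment> \<open>Chosen to make \<open>a + 1\<close> and the clique degree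
    \<open>card H - 1\<close> add up to \<open>2 * k + 2\<close>.\<close>
  define a where "a = 2 * k + 2 - card H"
  have a: "card H = 2 * k + 2 - a" "1 \<le> a" "a \<le> k" using h1 h2 by (auto simp: a_def)
  have low: "\<exists>x\<in>S - H. deg A S x \<le> a" if S: "H \<subset> S" "S \<subseteq> W" for S
  proof (rule ccontr)
    assume "\<not> ?thesis"
    then have Sdeg: "a + 1 \<le> deg A S x" if "x \<in> S - H" for x using that by force
    obtain x where x: "x \<in> S" "x \<notin> H" using S by blast
    \<comment> \<open>A vertex that sees all of \<open>H\<close> could be added to \<open>H\<close>,
      which is largest.\<close>
    have "\<exists>y\<in>H. \<not> A x y"
    proof (rule ccontr)
      assume "\<not> (\<exists>y\<in>H. \<not> A x y)"
      then have all: "A x y" if "y \<in> H" for y using that by blast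
      have "k + 1 \<le> deg A (insert x H) y" if "y \<in> insert x H" for y
      proof (cases "y = x")
        case True
        have "{u \<in> H. A x u} = H" using all by blast
        then have "deg A H x = card H" by (simp add: deg_def)
        then show ?thesis using True deg_insert[OF fH x(2), of x] irrefl h1 by simp
      next
        case False
        then show ?thesis using that Hdeg[of y] deg_insert[OF fH x(2), of y] by simp
      qed
      then have "F (insert x H)" using HW S x by (auto simp: F_def)
      then show False using H_max[of "insert x H"] fH x by simp
    qed
    then obtain y where y: "y \<in> H" "\<not> A x y" by blast
    have "\<exists>zs. cycle A W zs \<and> 2 * k + 2 \<le> length zs"
    proof (rule nonadjacent_pair_long_cycle[OF fin bi far])
      show "S - H \<subseteq> W" "S \<subseteq> W" "H \<subseteq> W" using S by auto
      show "x \<in> S - H" "y \<in> H" "x \<noteq> y" "\<not> A x y" using x y by auto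
      show "a + 1 \<le> deg A S u" if "u \<in> S - H" for u using Sdeg[OF that] .
      show "card H - 1 \<le> deg A H u" if "u \<in> H" for u using degH[OF that] by simp
      show "1 \<le> a + 1" "1 \<le> card H - 1" "2 * k + 2 \<le> a + 1 + (card H - 1)" "2 \<le> 2 * k + 2"
        using a h1 by auto
      show "A u v" if "u \<in> S" "u \<notin> S - H" "v \<in> H" "v \<noteq> u" for u v using that complete by auto
    qed
    then show False using no by blast
  qed
  have "arcs A W \<le> arcs A H + 2 * a * card (W - H)" using arcs_peel[OF fin HW low] .
  moreover have "arcs A H \<le> card H * (card H - 1)" using arcs_le[OF fH] .
  moreover have cWH: "card (W - H) = j + a - 2"
    using card a h2 HW fH by (simp add: card_Diff_subset)
  ultimately have "arcs A W \<le> (2 * k + 2 - a) * (2 * k + 1 - a) + 2 * a * (j + a - 2)"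
    using a by simp
  \<comment> \<open>The first vertex peeled off has degree at most \<open>a\<close> in all of
    \<open>W\<close>; here the minimum degree enters.\<close>
  moreover have "j \<le> a"
  proof -
    have "H \<noteq> W" using card h2 j by auto
    then obtain x where x: "x \<in> W - H" "deg A W x \<le> a" using low[of W] HW by blast
    then show ?thesis using min_deg[of x] by simp
  qed
  ultimately show False using clique_count[OF j, of a k] a(3) e by simp
qed

end

lemma path_relation_mono: "path A W xs \<Longrightarrow> (\<And>x y. A x y \<Longrightarrow> B x y) \<Longrightarrow> path B W xs"
  unfolding path_def by (auto elim: successively_mono)

lemma deg_relation_mono: "finite W \<Longrightarrow> (\<And>x y. A x y \<Longrightarrow> B x y) \<Longrightarrow> deg A W v \<le> deg B W v"
  unfolding deg_def by (rule card_mono) auto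

text \<open>Rotate the cycle so that a step outside \<open>A\<close> becomes the closing one. A
  cycle has at least three vertices, so the new edge occurs on it only once and the remaining steps
  lie in \<open>A\<close>.\<close>

lemma cycle_add_edge:
  assumes c: "cycle B W zs" and B: "\<And>u v. B u v \<Longrightarrow> A u v \<or> {u, v} = {x, y}"
  shows "cycle A W zs \<or> (\<exists>ys. path A W ys \<and> length ys = length zs \<and> {hd ys, last ys} = {x, y})"
proof (cases "\<forall>i. A (last (rotate i zs)) (hd (rotate i zs))")
  case True
  have ne: "zs \<noteq> []" using path_nonempty[OF cycle_path[OF c]] .
  have "A (zs ! i) (zs ! Suc i)" if "Suc i < length zs" for i
  proof -
    have "hd (rotate (Suc i) zs) = zs ! Suc i" using hd_rotate_conv_nth[OF ne, of "Suc i"] that by simp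
    moreover have "last (rotate (Suc i) zs) = hd (rotate i zs)" using ne by (cases "rotate i zs") auto
    then have "last (rotate (Suc i) zs) = zs ! i" using hd_rotate_conv_nth[OF ne, of i] that by simp
    ultimately show ?thesis using True by metis
  qed
  then have "successively A zs" by (simp add: successively_conv_nth)
  moreover have "A (last zs) (hd zs)" using True[rule_format, of 0] by simp
  ultimately show ?thesis using c by (auto simp: cycle_def path_def)
next
  case False
  then obtain i where i: "\<not> A (last (rotate i zs)) (hd (rotate i zs))" by blast
  define ys where "ys = rotate i zs"
  have ys: "cycle B W ys" "length ys = length zs" using cycle_rotate[OF c] by (auto simp: ys_def)
  have p: "path B W ys" using cycle_path[OF ys(1)] .
  have n3: "3 \<le> length ys" using ys(1) by (simp add: cycle_def)
  have hl: "{hd ys, last ys} = {x, y}" using i ys(1) B unfolding ys_def cycle_def by blast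
  have h: "hd ys = ys ! 0" "last ys = ys ! (length ys - 1)" using path_hd[OF p] path_last[OF p] by auto
  have inj: "i = j" if "ys ! i = ys ! j" "i < length ys" "j < length ys" for i j
    using that path_distinct[OF p] by (simp add: nth_eq_iff_index_eq)
  have "A (ys ! i) (ys ! Suc i)" if i: "Suc i < length ys" for i
  proof (rule ccontr)
    assume "\<not> A (ys ! i) (ys ! Suc i)"
    then have "{ys ! i, ys ! Suc i} = {ys ! 0, ys ! (length ys - 1)}"
      using B[OF path_step[OF p i]] hl h by auto
    then consider "ys ! i = ys ! 0" "ys ! Suc i = ys ! (length ys - 1)"
      | "ys ! i = ys ! (length ys - 1)" by (auto simp: doubleton_eq_iff)
    then show False
    proof cases
      case 1
      then have "i = 0" "Suc i = length ys - 1" using i by (auto intro!: inj)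
      then show False using n3 by simp
    next
      case 2
      then have "i = length ys - 1" using i by (intro inj) auto
      then show False using i by simp
    qed
  qed
  then have "path A W ys" using p by (simp add: path_def successively_conv_nth)
  then show ?thesis using hl ys(2) by blast
qed

text \<open>Induction over the missing edges stands in for choosing an edge-maximal counterexample.
  If some non-adjacent pair is not joined by a path on at least \<open>2 * k + 2\<close> vertices,
  adding its edge keeps all hypotheses, and a long cycle through the new edge would leave just such
  a path.\<close>

lemma long_cycle:
  assumes "sgraph A" "finite W" "biconnected A W" "card W = 2 * k + j" "1 \<le> k" "2 \<le> j"
    and "\<And>v. v \<in> W \<Longrightarrow> j \<le> deg A W v" "(2 * k + 1) * (2 * k) + j * (j - 1) \<le> arcs A W"
  shows "\<exists>zs. cycle A W zs \<and> 2 * k + 2 \<le> length zs"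
  using assms
proof (induction "card {(x, y) \<in> W \<times> W. \<not> A x y}" arbitrary: A rule: less_induct)
  case less
  interpret sgraph A by fact
  show ?case
  proof (rule ccontr)
    assume no: "\<not> ?case"
    have "\<exists>x\<in>W. \<exists>y\<in>W. x \<noteq> y \<and> \<not> A x y \<and>
        \<not> (\<exists>xs. path A W xs \<and> hd xs = x \<and> last xs = y \<and> 2 * k + 2 \<le> length xs)"
      using edge_maximal_long_cycle[OF less.prems(2-8)] no by blast
    then obtain x y where xy: "x \<in> W" "y \<in> W" "x \<noteq> y" "\<not> A x y"
      and none: "\<not> (\<exists>xs. path A W xs \<and> hd xs = x \<and> last xs = y \<and> 2 * k + 2 \<le> length xs)" by blast
    define B where "B u v \<longleftrightarrow> A u v \<or> (u = x \<and> v = y) \<or> (u = y \<and> v = x)" for u v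
    have AB: "B u v" if "A u v" for u v using that by (simp add: B_def)
    have deg_AB: "deg A W v \<le> deg B W v" for v using less.prems(2) AB by (rule deg_relation_mono)
    have "sgraph B" using xy(3) sym irrefl by unfold_locales (auto simp: B_def)
    moreover have "biconnected B W"
      unfolding biconnected_def
    proof (intro ballI)
      fix w u v assume "w \<in> W" "u \<in> W - {w}" "v \<in> W - {w}"
      then obtain xs where xs: "path A (W - {w}) xs" "hd xs = u" "last xs = v"
        using less.prems(3) unfolding biconnected_def by blast
      have "path B (W - {w}) xs" using xs(1) AB by (rule path_relation_mono)
      then show "\<exists>xs. path B (W - {w}) xs \<and> hd xs = u \<and> last xs = v" using xs by blast
    qed
    moreover have "arcs A W \<le> arcs B W" unfolding arcs_def by (rule sum_mono) (rule deg_AB)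
    moreover have "card {(u, v) \<in> W \<times> W. \<not> B u v} < card {(u, v) \<in> W \<times> W. \<not> A u v}"
    proof (rule psubset_card_mono)
      show "finite {(u, v) \<in> W \<times> W. \<not> A u v}"
        using less.prems(2) by (auto intro: finite_subset[of _ "W \<times> W"])
      have "(x, y) \<in> {(u, v) \<in> W \<times> W. \<not> A u v}" "(x, y) \<notin> {(u, v) \<in> W \<times> W. \<not> B u v}"
        using xy by (auto simp: B_def)
      moreover have "{(u, v) \<in> W \<times> W. \<not> B u v} \<subseteq> {(u, v) \<in> W \<times> W. \<not> A u v}" using AB by auto
      ultimately show "{(u, v) \<in> W \<times> W. \<not> B u v} \<subset> {(u, v) \<in> W \<times> W. \<not> A u v}" by blast
    qed
    ultimately have "\<exists>zs. cycle B W zs \<and> 2 * k + 2 \<le> length zs"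
      using less.prems(2,4-8) order_trans[OF _ deg_AB] by (intro less.hyps) (auto intro: order_trans)
    then obtain zs where zs: "cycle B W zs" "2 * k + 2 \<le> length zs" by blast
    then have "\<not> cycle A W zs" using no by blast
    moreover have "A u v \<or> {u, v} = {x, y}" if "B u v" for u v using that by (auto simp: B_def)
    ultimately obtain ys where ys: "path A W ys" "length ys = length zs" "{hd ys, last ys} = {x, y}"
      using cycle_add_edge[OF zs(1), of A x y] by blast
    have ne: "ys \<noteq> []" using path_nonempty[OF ys(1)] .
    consider "hd ys = x" "last ys = y" | "hd ys = y" "last ys = x"
      using ys(3) by (auto simp: doubleton_eq_iff)
    then show False
    proof cases
      case 1
      then show False using none ys zs(2) by auto
    next
      case 2
      then have "hd (rev ys) = x" "last (rev ys) = y" using ne by (auto simp: hd_rev last_rev)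
      then show False using none path_rev[OF ys(1)] ys(2) zs(2) by (metis length_rev)
    qed
  qed
qed

section \<open>Even cycles in dense graphs\<close>

text \<open>Strict convexity of x(x + 1): \<open>r\<close> and \<open>s\<close> have the same sum as
  \<open>2 * k\<close> and \<open>j - 1\<close> and lie strictly between them.\<close>

lemma cut_vertex_count:
  fixes r s k j :: nat
  assumes "1 \<le> j" "j \<le> r" "j \<le> s" "r + s + 1 = 2 * k + j"
  shows "(r + 1) * r + (s + 1) * s < (2 * k + 1) * (2 * k) + j * (j - 1)"
proof -
  obtain i where i: "j = Suc i" using assms(1) by (cases j) auto
  obtain a where a: "r = j + a" using assms(2) le_Suc_ex by blast
  obtain b where b: "s = j + b" using assms(3) le_Suc_ex by blast
  have k: "2 * k = i + a + b + 2" using assms(4) a b i by simp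
  show ?thesis unfolding k by (simp add: a b i algebra_simps)
qed

lemma card_exchange: "finite S \<Longrightarrow> u \<in> S \<Longrightarrow> x \<notin> S \<Longrightarrow> card (insert x (S - {u})) = card S"
  by (metis card.remove card_insert_disjoint finite_Diff DiffD1)

lemma subset_list:
  assumes "finite S" "m \<le> card S"
  obtains xs where "distinct xs" "set xs \<subseteq> S" "length xs = m"
proof -
  obtain T where T: "T \<subseteq> S" "card T = m" "finite T" using obtain_subset_with_card_n[OF assms(2)] by blast
  obtain xs where "set xs = T" "distinct xs" using finite_distinct_list[OF T(3)] by blast
  then show ?thesis using that T distinct_card by metis
qed

context sgraph begin

text \<open>A cut vertex leaves at most the arcs of two cliques sharing it. Minimum degree
  \<open>j\<close> puts at least \<open>j\<close> vertices on either side, which excludes the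
  extremal split into \<open>2 * k\<close> and \<open>j - 1\<close>.\<close>

lemma dense_biconnected:
  assumes fin: "finite W" and card: "card W = 2 * k + j" and j: "1 \<le> j"
    and min_deg: "\<And>v. v \<in> W \<Longrightarrow> j \<le> deg A W v"
    and e: "(2 * k + 1) * (2 * k) + j * (j - 1) \<le> arcs A W"
  shows "biconnected A W"
proof (rule ccontr)
  assume "\<not> ?thesis"
  then obtain w x y where w: "w \<in> W" and x: "x \<in> W - {w}" and y: "y \<in> W - {w}"
    and sep: "\<not> (\<exists>xs. path A (W - {w}) xs \<and> hd xs = x \<and> last xs = y)"
    unfolding biconnected_def by blast
  define R where "R = {u. \<exists>xs. path A (W - {w}) xs \<and> hd xs = x \<and> last xs = u}"
  define S where "S = W - {w} - R"
  have RW: "R \<subseteq> W - {w}"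
  proof
    fix u assume "u \<in> R"
    then obtain xs where xs: "path A (W - {w}) xs" "last xs = u" by (auto simp: R_def)
    then show "u \<in> W - {w}" using path_subset[OF xs(1)] last_in_set[OF path_nonempty[OF xs(1)]] by auto
  qed
  have xR: "x \<in> R" using path_single[OF x] by (force simp: R_def)
  have yS: "y \<in> S" using y sep by (auto simp: S_def R_def)
  have noRS: "\<not> A u v" if u: "u \<in> R" and v: "v \<in> S" for u v
  proof
    assume uv: "A u v"
    obtain xs where xs: "path A (W - {w}) xs" "hd xs = x" "last xs = u" using u by (auto simp: R_def)
    have ne: "xs \<noteq> []" using path_nonempty[OF xs(1)] .
    have "v \<in> R"
    proof (cases "v \<in> set xs")
      case True
      then obtain ps qs where "xs = (ps @ [v]) @ qs" by (metis append.assoc append_Cons append_Nil split_list)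
      then have "path A (W - {w}) (ps @ [v])" "hd (ps @ [v]) = x"
        using xs path_append_left[of A "W - {w}" "ps @ [v]" qs] by (auto simp: hd_append)
      then show ?thesis unfolding R_def by (intro CollectI exI[of _ "ps @ [v]"]) simp
    next
      case False
      have "path A (W - {w}) (xs @ [v])"
        using xs False uv v by (intro path_append path_single) (auto simp: S_def)
      then show ?thesis using xs(2) ne unfolding R_def by (intro CollectI exI[of _ "xs @ [v]"]) simp
    qed
    then show False using v by (simp add: S_def)
  qed
  have fRS: "finite R" "finite S" using RW fin by (auto simp: S_def intro: finite_subset)
  have WRS: "W = insert w (R \<union> S)" and disj: "R \<inter> S = {}" "w \<notin> R" "w \<notin> S"
    using RW w by (auto simp: S_def)
  have degR: "deg A W u \<le> card R" if "u \<in> R" for u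
  proof -
    have "{v \<in> W. A u v} \<subseteq> insert w (R - {u})" using WRS noRS[OF that] irrefl by auto
    then have "deg A W u \<le> card (insert w (R - {u}))" unfolding deg_def using fRS by (intro card_mono) auto
    also have "\<dots> = card R" using that fRS disj by (intro card_exchange) auto
    finally show ?thesis .
  qed
  have degS: "deg A W u \<le> card S" if "u \<in> S" for u
  proof -
    have "{v \<in> W. A u v} \<subseteq> insert w (S - {u})" using WRS noRS[OF _ that] irrefl sym by auto
    then have "deg A W u \<le> card (insert w (S - {u}))" unfolding deg_def using fRS by (intro card_mono) auto
    also have "\<dots> = card S" using that fRS disj by (intro card_exchange) auto
    finally show ?thesis .
  qed
  have cW: "card W = Suc (card R + card S)"
    unfolding WRS using fRS disj by (simp add: card_Un_disjoint)
  have "arcs A W = deg A W w + (\<Sum>u\<in>R. deg A W u) + (\<Sum>u\<in>S. deg A W u)"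
  proof -
    have "arcs A W = (\<Sum>u\<in>insert w (R \<union> S). deg A W u)" unfolding arcs_def using WRS by simp
    then show ?thesis using fRS disj by (simp add: sum.union_disjoint)
  qed
  moreover have "deg A W w \<le> card R + card S" using deg_le[OF fin w] cW by simp
  moreover have "(\<Sum>u\<in>R. deg A W u) \<le> card R * card R" using sum_bounded_above[of R "deg A W" "card R"] degR by simp
  moreover have "(\<Sum>u\<in>S. deg A W u) \<le> card S * card S" using sum_bounded_above[of S "deg A W" "card S"] degS by simp
  ultimately have "arcs A W \<le> (card R + 1) * card R + (card S + 1) * card S" by (simp add: algebra_simps)
  moreover have "j \<le> card R" using min_deg[of x] x degR[OF xR] by auto
  moreover have "j \<le> card S" using min_deg[of y] y degS[OF yS] by auto
  ultimately show False using cut_vertex_count[OF j, of "card R" "card S" k] cW card e by simp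
qed

lemma dense_even_cycles:
  assumes fin: "finite W" and card: "card W = 2 * k + j" and k: "1 \<le> k" and j: "2 \<le> j" "j \<le> 2 * k + 1"
    and min_deg: "\<And>v. v \<in> W \<Longrightarrow> j \<le> deg A W v"
    and e: "(2 * k + 1) * (2 * k) + j * (j - 1) \<le> arcs A W"
    and L: "even L" "4 \<le> L" "L \<le> 2 * k + 2"
  shows "\<exists>zs. cycle A W zs \<and> length zs = L"
proof -
  have j1: "1 \<le> j" using j by simp
  have bi: "biconnected A W" using dense_biconnected[OF fin card j1 min_deg e] .
  have "\<exists>zs. cycle A W zs \<and> 2 * k + 2 \<le> length zs"
    using long_cycle[OF sgraph_axioms fin bi card k j(1) min_deg e] .
  then obtain zs0 where zs0: "cycle A W zs0" "2 * k + 2 \<le> length zs0" by blast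
  have "\<forall>zs. cycle A W zs \<longrightarrow> length zs < Suc (card W)"
    using cycle_length_le[OF _ fin] by (auto simp: less_Suc_eq_le)
  then obtain cs where cs: "cycle A W cs" and longest: "\<And>zs. cycle A W zs \<Longrightarrow> length zs \<le> length cs"
    using ex_has_greatest_nat[of "cycle A W" zs0 length] zs0(1) by blast
  have c: "2 * k + 2 \<le> length cs" using longest[OF zs0(1)] zs0(2) by simp
  have sub: "set cs \<subseteq> W" using path_subset[OF cycle_path[OF cs]] .
  have ccs: "card (set cs) = length cs" using path_distinct[OF cycle_path[OF cs]] by (rule distinct_card)
  show ?thesis
  proof (cases "j = 2 * k")
    case True
    \<comment> \<open>Here \<open>j\<close> is exactly half the order, so no vertex can have the low
      degree that lying off a longest cycle would entail.\<close>
    have min_deg': "card W \<le> 2 * deg A W v" if "v \<in> W" for v using min_deg[OF that] card True by simp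
    have "W - set cs = {}"
    proof (rule ccontr)
      assume ne: "W - set cs \<noteq> {}"
      have "card (W - set cs) \<le> length cs"
        using sub ccs c card True by (simp add: card_Diff_subset)
      then obtain v where "v \<in> W - set cs" "2 * deg A W v \<le> card W - 1"
        using low_degree_off_longest_cycle[OF fin cs longest ne] by blast
      then show False using min_deg'[of v] card k by auto
    qed
    then have "set cs = W" using sub by blast
    then show ?thesis
      using even_cycles_of_min_degree[OF cs _ _ _ min_deg' L(1,2)] ccs card True L(3) j by simp
  next
    case False
    have "card W * card W < 2 * arcs A W"
    \<comment> \<open>Twice the arc bound minus the square of \<open>card W\<close> is d(d + 2) for
      d = 2k - j. Only d = -1 spoils it, and there every degree exceeds half the order.\<close>
    proof (cases "j = 2 * k + 1")
      case True
      have "card W * j \<le> arcs A W"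
        unfolding arcs_def using sum_bounded_below[of W j "deg A W"] min_deg by simp
      then have "card W * (2 * j) \<le> 2 * arcs A W" by simp
      moreover have "card W * card W < card W * (2 * j)" using card True by simp
      ultimately show ?thesis by linarith
    next
      case j': False
      then have "j \<le> 2 * k" using j(2) by simp
      then obtain p where p: "2 * k = j + p" using le_Suc_ex by blast
      have "p \<noteq> 0" using p False by auto
      obtain i where i: "j = Suc i" using j1 by (cases j) auto
      have "card W * card W < 2 * ((2 * k + 1) * (2 * k) + j * (j - 1))"
        unfolding card p using \<open>p \<noteq> 0\<close> by (simp add: i algebra_simps)
      then show ?thesis using e by (meson less_le_trans mult_le_mono2)
    qed
    then show ?thesis using weakly_pancyclic[OF fin cs longest] card c j L by simp
  qed
qed

section \<open>The extremal graph and one more vertex\<close>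

lemma clique_cycle_through_vertex:
  assumes K: "finite K" "\<And>x y. x \<in> K \<Longrightarrow> y \<in> K \<Longrightarrow> x \<noteq> y \<Longrightarrow> A x y" and W: "K \<subseteq> W" "v \<in> W" "v \<notin> K"
    and ab: "a \<in> K" "b \<in> K" "a \<noteq> b" "A v a" "A v b" and L: "3 \<le> L" "L \<le> card K + 1"
  shows "\<exists>zs. cycle A W zs \<and> length zs = L"
proof -
  have "L - 3 \<le> card (K - {a, b})" using L ab K(1) by (simp add: card_Diff_subset)
  then obtain zs where zs: "distinct zs" "set zs \<subseteq> K - {a, b}" "length zs = L - 3"
    using subset_list[of "K - {a, b}"] K(1) by blast
  have ap: "path A W (a # zs @ [b])"
    using zs ab W by (intro complete_path K(2)) auto
  then have "path A W (v # a # zs @ [b])"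
    using W ab zs by (intro path_Cons[OF ap]) auto
  then have "cycle A W (v # a # zs @ [b])" using ab sym by (simp add: cycle_def)
  moreover have "length (v # a # zs @ [b]) = L" using zs(3) L by simp
  ultimately show ?thesis by blast
qed

text \<open>The extremal graph with its parts named, seen as two cliques sharing \<open>x\<close>.
  \<open>Y\<close> may be empty: a complete graph with a marked vertex starts the induction at
  \<open>2 * k + 1\<close> vertices, one below the range of the theorem.\<close>

definition joined_cliques :: "'a set \<Rightarrow> 'a \<Rightarrow> 'a set \<Rightarrow> 'a set \<Rightarrow> bool" where
  "joined_cliques W x X Y \<longleftrightarrow> W = insert x (X \<union> Y) \<and> x \<notin> X \<and> x \<notin> Y \<and> X \<inter> Y = {} \<and>
     (\<forall>u\<in>W. \<forall>v\<in>W. A u v \<longleftrightarrow> u \<noteq> v \<and> (u \<in> insert x X \<and> v \<in> insert x X \<or> u \<in> insert x Y \<and> v \<in> insert x Y))"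

lemma joined_cliques_arcs:
  assumes "joined_cliques W x X Y" "finite W"
  shows "arcs A W = (card X + 1) * card X + (card Y + 1) * card Y"
proof -
  have W: "W = insert x (X \<union> Y)" and n: "x \<notin> X" "x \<notin> Y" "X \<inter> Y = {}" and f: "finite X" "finite Y"
    and A: "\<And>u v. u \<in> W \<Longrightarrow> v \<in> W \<Longrightarrow> A u v \<longleftrightarrow> u \<noteq> v \<and>
      (u \<in> insert x X \<and> v \<in> insert x X \<or> u \<in> insert x Y \<and> v \<in> insert x Y)"
    using assms by (auto simp: joined_cliques_def)
  have "deg A W u = card X" if u: "u \<in> X" for u
  proof -
    have "{v \<in> W. A u v} = insert x (X - {u})" using A[of u] u W n by auto
    then show ?thesis using card_exchange[OF f(1) u n(1)] by (simp only: deg_def)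
  qed
  moreover have "deg A W u = card Y" if u: "u \<in> Y" for u
  proof -
    have "{v \<in> W. A u v} = insert x (Y - {u})" using A[of u] u W n by auto
    then show ?thesis using card_exchange[OF f(2) u n(2)] by (simp only: deg_def)
  qed
  moreover have "deg A W x = card X + card Y"
  proof -
    have "{v \<in> W. A x v} = X \<union> Y" using A[of x] W n by auto
    then show ?thesis using f n by (simp add: deg_def card_Un_disjoint)
  qed
  moreover have "arcs A W = deg A W x + (\<Sum>u\<in>X. deg A W u) + (\<Sum>u\<in>Y. deg A W u)"
  proof -
    have "arcs A W = (\<Sum>u\<in>insert x (X \<union> Y). deg A W u)" unfolding arcs_def using W by simp
    then show ?thesis using f n by (simp add: sum.union_disjoint)
  qed
  ultimately show ?thesis by simp
qed

text \<open>Two neighbours of \<open>v\<close> in the clique on \<open>insert x X\<close> give all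
  lengths through that clique. Otherwise the degree forces \<open>v\<close> to see all of
  \<open>Y\<close> and exactly one clique vertex \<open>w\<close>. For \<open>w = x\<close> the
  smaller clique has grown, and for \<open>w\<close> in \<open>X\<close> with some \<open>y\<close>
  in \<open>Y\<close> there are cycles through \<open>v\<close>, \<open>y\<close>, \<open>x\<close>,
  \<open>w\<close>.\<close>

lemma joined_cliques_add_vertex:
  assumes k: "1 \<le> k" and fin: "finite W" and v: "v \<in> W" and jc: "joined_cliques (W - {v}) x X Y"
    and X: "card X = 2 * k" and d: "deg A W v = card Y + 1"
  shows "(\<exists>x X Y. joined_cliques W x X Y \<and> card X = 2 * k) \<or>
    (\<forall>L. even L \<longrightarrow> 4 \<le> L \<longrightarrow> L \<le> 2 * k + 2 \<longrightarrow> (\<exists>zs. cycle A W zs \<and> length zs = L))"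
proof -
  let ?K = "insert x X"
  have W: "W - {v} = insert x (X \<union> Y)" and n: "x \<notin> X" "x \<notin> Y" "X \<inter> Y = {}"
    and A: "\<And>u w. u \<in> W - {v} \<Longrightarrow> w \<in> W - {v} \<Longrightarrow> A u w \<longleftrightarrow> u \<noteq> w \<and>
      (u \<in> insert x X \<and> w \<in> insert x X \<or> u \<in> insert x Y \<and> w \<in> insert x Y)"
    using jc unfolding joined_cliques_def by blast+
  have XW: "?K \<subseteq> W - {v}" "Y \<subseteq> W - {v}" using W by auto
  have f: "finite X" "finite Y" using XW fin finite_subset[of _ "W - {v}"] by auto
  have vn: "v \<notin> ?K" "v \<notin> Y" using XW by auto
  have K: "A u w" if "u \<in> ?K" "w \<in> ?K" "u \<noteq> w" for u w using A[of u w] that XW by blast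
  have cK: "card ?K = 2 * k + 1" using f n X by simp
  define N where "N = {u \<in> W - {v}. A v u}"
  have cN: "card N = card Y + 1"
    using d deg_remove_self[of W v] by (simp add: N_def deg_def)
  have NA: "A v u \<longleftrightarrow> u \<in> N" if "u \<in> W - {v}" for u using that by (simp add: N_def)
  have fN: "finite N" using fin by (simp add: N_def)
  show ?thesis
  proof (cases "\<exists>a\<in>N \<inter> ?K. \<exists>b\<in>N \<inter> ?K. a \<noteq> b")
    case True
    then obtain a b where ab: "a \<in> ?K" "b \<in> ?K" "a \<noteq> b" "A v a" "A v b" by (auto simp: N_def)
    have "\<exists>zs. cycle A W zs \<and> length zs = L" if "4 \<le> L" "L \<le> 2 * k + 2" for L
      using that cK XW f(1) by (intro clique_cycle_through_vertex[OF _ K _ v vn(1) ab]) auto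
    then show ?thesis by blast
  next
    case False
    have NY: "card (N \<inter> ?K) \<le> 1" using False fN by (intro card_le_Suc0_iff_eq[THEN iffD2, folded One_nat_def]) auto
    have Nsub: "N = (N \<inter> ?K) \<union> (N \<inter> Y)" using W by (auto simp: N_def)
    have "card N = card (N \<inter> ?K) + card (N \<inter> Y)"
      using Nsub fN n by (subst Nsub, intro card_Un_disjoint) auto
    moreover have "card (N \<inter> Y) \<le> card Y" using f by (intro card_mono) auto
    ultimately have "card (N \<inter> ?K) = 1" "card (N \<inter> Y) = card Y" using cN NY by linarith+
    then obtain w where w: "N \<inter> ?K = {w}" and "N \<inter> Y = Y"
      using card_subset_eq[of Y "N \<inter> Y"] f by (metis card_1_singletonE inf_le2)
    then have N: "N = insert w Y" and wK: "w \<in> ?K" using Nsub by auto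
    consider "w = x" | "w \<in> X" "Y = {}" | y where "w \<in> X" "y \<in> Y" using wK by blast
    then show ?thesis
    proof cases
      case 1
      have "joined_cliques W x X (insert v Y)"
        unfolding joined_cliques_def
      proof (intro conjI ballI)
        show "W = insert x (X \<union> insert v Y)" using W v by auto
        show "x \<notin> X" "x \<notin> insert v Y" "X \<inter> insert v Y = {}" using n vn by auto
        fix u u' assume u: "u \<in> W" "u' \<in> W"
        show "A u u' \<longleftrightarrow> u \<noteq> u' \<and> (u \<in> insert x X \<and> u' \<in> insert x X \<or>
          u \<in> insert x (insert v Y) \<and> u' \<in> insert x (insert v Y))"
          using A[of u u'] NA[of u] NA[of u'] u N 1 irrefl[of v] sym_iff[of v u] vn n
          by (cases "u = v"; cases "u' = v") auto
      qed
      then show ?thesis using X by blast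
    next
      case 2
      \<comment> \<open>With \<open>Y\<close> empty, \<open>x\<close> was just any vertex of the
        clique; the pendant vertex \<open>v\<close> makes its neighbour \<open>w\<close> the shared
        one.\<close>
      let ?X = "insert x X - {w}"
      have "joined_cliques W w ?X {v}"
        unfolding joined_cliques_def
      proof (intro conjI ballI)
        show "W = insert w (?X \<union> {v})" using W v 2 by auto
        show "w \<notin> ?X" "w \<notin> {v}" "?X \<inter> {v} = {}" using 2 vn by auto
        fix u u' assume u: "u \<in> W" "u' \<in> W"
        show "A u u' \<longleftrightarrow> u \<noteq> u' \<and> (u \<in> insert w ?X \<and> u' \<in> insert w ?X \<or>
          u \<in> insert w {v} \<and> u' \<in> insert w {v})"
          using A[of u u'] NA[of u] NA[of u'] u N 2 irrefl[of v] sym_iff[of v u] vn n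
          by (cases "u = v"; cases "u' = v") auto
      qed
      moreover have "card ?X = 2 * k" using cK wK f by simp
      ultimately show ?thesis by blast
    next
      case 3
      have "\<exists>zs. cycle A W zs \<and> length zs = L" if L: "4 \<le> L" "L \<le> 2 * k + 2" for L
      proof -
        \<comment> \<open>The vertices \<open>v\<close>, \<open>y\<close>, \<open>x\<close> and
          \<open>w\<close> are fixed, and the rest of the cycle comes from \<open>X\<close>.\<close>
        have "L - 4 \<le> card (X - {w})" using L X 3 f k by simp
        then obtain zs where zs: "distinct zs" "set zs \<subseteq> X - {w}" "length zs = L - 4"
          using subset_list[of "X - {w}"] f by blast
        have q1: "path A W (x # zs @ [w])"
          using zs 3 XW n by (intro complete_path K) auto
        have yW: "y \<in> W" "y \<noteq> v" "y \<noteq> x" "y \<notin> X" using 3 XW vn n by auto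
        have "A y x" using A[of y x] 3 XW n by auto
        then have q2: "path A W (y # x # zs @ [w])"
          using yW zs 3 by (intro path_Cons[OF q1]) auto
        have "A v y" "A v w" using NA N 3 XW by auto
        then have "path A W (v # y # x # zs @ [w])"
          using v vn yW zs 3 by (intro path_Cons[OF q2]) auto
        then have "cycle A W (v # y # x # zs @ [w])" using sym[OF \<open>A v w\<close>] by (simp add: cycle_def)
        moreover have "length (v # y # x # zs @ [w]) = L" using zs(3) L by simp
        ultimately show ?thesis by blast
      qed
      then show ?thesis by blast
    qed
  qed
qed

lemma even_cycles_or_joined_cliques:
  assumes k: "1 \<le> k"
  shows "finite W \<Longrightarrow> card W = 2 * k + 1 + m \<Longrightarrow> m \<le> 2 * k \<Longrightarrow>
    (2 * k + 1) * (2 * k) + (m + 1) * m \<le> arcs A W \<Longrightarrow>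
    (\<exists>x X Y. joined_cliques W x X Y \<and> card X = 2 * k) \<or>
    (\<forall>L. even L \<longrightarrow> 4 \<le> L \<longrightarrow> L \<le> 2 * k + 2 \<longrightarrow> (\<exists>zs. cycle A W zs \<and> length zs = L))"
proof (induction m arbitrary: W)
  case 0
  have complete: "A u v" if uv: "u \<in> W" "v \<in> W" "u \<noteq> v" for u v
  proof (rule ccontr)
    assume "\<not> A u v"
    then have "{w \<in> W. A u w} \<subseteq> W - {u, v}" using irrefl by auto
    then have "deg A W u \<le> card (W - {u, v})" unfolding deg_def using 0 by (intro card_mono) auto
    also have "\<dots> < 2 * k" using uv 0 k by (simp add: card_Diff_subset)
    finally have lt: "deg A W u < 2 * k" .
    have "arcs A W < (\<Sum>w\<in>W. 2 * k)"
      unfolding arcs_def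
    proof (rule sum_strict_mono_ex1)
      show "\<forall>w\<in>W. deg A W w \<le> 2 * k" using deg_le[of W] 0 by auto
    qed (use 0 uv lt in auto)
    then show False using 0 by simp
  qed
  have "W \<noteq> {}" using 0 by auto
  then obtain x where x: "x \<in> W" by blast
  have "joined_cliques W x (W - {x}) {}"
    unfolding joined_cliques_def using x complete irrefl by (auto simp: insert_absorb)
  moreover have "card (W - {x}) = 2 * k" using 0 x by simp
  ultimately show ?case by blast
next
  case (Suc m)
  show ?case
  proof (cases "\<exists>v\<in>W. deg A W v \<le> m + 1")
    case True
    then obtain v where v: "v \<in> W" "deg A W v \<le> m + 1" by blast
    have arcs: "arcs A W = arcs A (W - {v}) + 2 * deg A W v" using v Suc.prems by (intro arcs_remove) auto
    have fin: "finite (W - {v})" using Suc.prems by simp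
    have cardW: "card (W - {v}) = 2 * k + 1 + m" using Suc.prems v by simp
    have "(2 * k + 1) * (2 * k) + (m + 1) * m \<le> arcs A (W - {v})"
      using Suc.prems(4) arcs v(2) by (simp add: algebra_simps)
    then have "(\<exists>x X Y. joined_cliques (W - {v}) x X Y \<and> card X = 2 * k) \<or>
      (\<forall>L. even L \<longrightarrow> 4 \<le> L \<longrightarrow> L \<le> 2 * k + 2 \<longrightarrow> (\<exists>zs. cycle A (W - {v}) zs \<and> length zs = L))"
      using Suc.IH[OF fin cardW] Suc.prems(3) by simp
    then show ?thesis
    proof
      assume "\<exists>x X Y. joined_cliques (W - {v}) x X Y \<and> card X = 2 * k"
      then obtain x X Y where jc: "joined_cliques (W - {v}) x X Y" "card X = 2 * k" by blast
      have cY: "card Y = m"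
      proof -
        have "W - {v} = insert x (X \<union> Y)" "x \<notin> X" "x \<notin> Y" "X \<inter> Y = {}"
          using jc(1) by (auto simp: joined_cliques_def)
        moreover from this have "finite X" "finite Y" using fin finite_subset[of _ "W - {v}"] by auto
        ultimately have "card (W - {v}) = Suc (card X + card Y)" by (simp add: card_Un_disjoint)
        then show ?thesis using cardW jc(2) by simp
      qed
      \<comment> \<open>The extremal graph meets the bound with equality, so the deleted vertex must
        have had degree exactly \<open>m + 1\<close>.\<close>
      have "arcs A (W - {v}) = (2 * k + 1) * (2 * k) + (m + 1) * m"
        using joined_cliques_arcs[OF jc(1) fin] jc(2) cY by simp
      then have "deg A W v = card Y + 1" using arcs v(2) Suc.prems(4) cY by simp
      then show ?thesis using joined_cliques_add_vertex[OF k Suc.prems(1) v(1) jc] by simp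
    next
      assume "\<forall>L. even L \<longrightarrow> 4 \<le> L \<longrightarrow> L \<le> 2 * k + 2 \<longrightarrow> (\<exists>zs. cycle A (W - {v}) zs \<and> length zs = L)"
      then show ?thesis using cycle_mono[of A "W - {v}" _ W] by blast
    qed
  next
    case False
    then have min_deg: "m + 2 \<le> deg A W v" if "v \<in> W" for v using that by force
    have "card W = 2 * k + (m + 2)" "m + 2 \<le> 2 * k + 1"
      "(2 * k + 1) * (2 * k) + (m + 2) * (m + 2 - 1) \<le> arcs A W"
      using Suc.prems by (simp_all add: algebra_simps)
    then show ?thesis using dense_even_cycles[OF Suc.prems(1) _ k _ _ min_deg] by auto
  qed
qed

end

section \<open>The theorem for sets of edges\<close>

definition adj :: "'a set set \<Rightarrow> 'a \<Rightarrow> 'a \<Rightarrow> bool" where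
  "adj E u v \<longleftrightarrow> {u, v} \<in> E"

lemma simple_graph_edge:
  "simple_graph V E \<Longrightarrow> {u, v} \<in> E \<Longrightarrow> u \<in> V \<and> v \<in> V \<and> u \<noteq> v"
  unfolding simple_graph_def by (metis doubleton_eq_iff)

lemma sgraph_adj: "simple_graph V E \<Longrightarrow> sgraph (adj E)"
  by unfold_locales (simp add: adj_def insert_commute, metis adj_def simple_graph_edge)

lemma arcs_adj:
  assumes g: "simple_graph V E"
  shows "arcs (adj E) V = 2 * card E"
proof -
  have fV: "finite V" using g by (simp add: simple_graph_def)
  have EV: "E \<subseteq> Pow V" using g by (auto simp: simple_graph_def)
  have fE: "finite E" using finite_subset[OF EV] fV by simp
  have "deg (adj E) V v = card {e \<in> E. v \<in> e}" for v
  proof -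
    have "bij_betw (\<lambda>u. {v, u}) {u \<in> V. {v, u} \<in> E} {e \<in> E. v \<in> e}"
    proof (rule bij_betw_imageI)
      show "inj_on (\<lambda>u. {v, u}) {u \<in> V. {v, u} \<in> E}" by (auto simp: inj_on_def doubleton_eq_iff)
      show "(\<lambda>u. {v, u}) ` {u \<in> V. {v, u} \<in> E} = {e \<in> E. v \<in> e}"
      proof (intro equalityI subsetI)
        fix e assume e: "e \<in> {e \<in> E. v \<in> e}"
        then obtain a b where "a \<in> V" "b \<in> V" "e = {a, b}" using g by (auto simp: simple_graph_def)
        then obtain u where "u \<in> V" "e = {v, u}" using e by auto
        then show "e \<in> (\<lambda>u. {v, u}) ` {u \<in> V. {v, u} \<in> E}" using e by auto
      qed auto
    qed
    then show ?thesis by (simp add: deg_def adj_def bij_betw_same_card)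
  qed
  then have "arcs (adj E) V = (\<Sum>v\<in>V. card {e \<in> E. v \<in> e})" by (simp add: arcs_def)
  also have "\<dots> = 2 * card E"
  proof (rule sum_multicount[OF fV fE], intro ballI)
    fix e assume "e \<in> E"
    then obtain a b where ab: "a \<in> V" "b \<in> V" "a \<noteq> b" "e = {a, b}" using g by (auto simp: simple_graph_def)
    then have "{v \<in> V. v \<in> e} = {a, b}" by auto
    then show "card {v \<in> V. v \<in> e} = 2" using ab by simp
  qed
  finally show ?thesis .
qed

lemma has_cycle_of_cycle:
  assumes c: "cycle (adj E) V zs" shows "has_cycle V E (length zs)"
proof -
  have p: "path (adj E) V zs" and n: "3 \<le> length zs" and l: "adj E (last zs) (hd zs)"
    using c by (auto simp: cycle_def)
  have "{zs ! i, zs ! ((i + 1) mod length zs)} \<in> E" if i: "i < length zs" for i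
  proof (cases "Suc i < length zs")
    case True
    then show ?thesis using path_step[OF p True] by (simp add: adj_def)
  next
    case False
    then have "Suc i = length zs" using i by simp
    then have "i = length zs - 1" "(i + 1) mod length zs = 0" by auto
    then show ?thesis using l path_hd[OF p] path_last[OF p] by (simp add: adj_def)
  qed
  then show ?thesis
    unfolding has_cycle_def using n path_distinct[OF p] path_subset[OF p] by blast
qed

lemma two_choose_two: "2 * (n choose 2) = n * (n - 1)"
  by (cases n) (simp_all add: choose_two)

text \<open>The three families of edges regrouped as two cliques sharing the vertex 0, the shape of
  \<open>joined_cliques\<close>.\<close>

lemma join_edges_iff:
  assumes "p \<le> a + b" "q \<le> a + b"
  shows "{p, q} \<in> join_edges a b \<longleftrightarrow>
    p \<noteq> q \<and> (p \<le> a \<and> q \<le> a \<or> (p = 0 \<or> a < p) \<and> (q = 0 \<or> a < q))"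
  (is "?l \<longleftrightarrow> ?r")
proof
  assume ?l then show ?r unfolding join_edges_def by (auto simp: doubleton_eq_iff)
next
  assume r: ?r
  show ?l
  proof (cases "p = 0 \<or> q = 0")
    case True
    then show ?thesis using r assms unfolding join_edges_def by (force simp: doubleton_eq_iff)
  next
    case False
    then have "1 \<le> p" "1 \<le> q" by auto
    then show ?thesis using r assms unfolding join_edges_def by blast
  qed
qed

lemma (in sgraph) joined_cliques_iso:
  assumes fin: "finite V" and A: "A = adj E" and jc: "joined_cliques V x X Y"
  shows "graph_iso V E (join_verts (card X) (card Y)) (join_edges (card X) (card Y))"
proof -
  let ?a = "card X" and ?b = "card Y"
  have A_iff: "A u v \<longleftrightarrow> {u, v} \<in> E" for u v by (simp add: A adj_def)
  have V: "V = insert x (X \<union> Y)" and n: "x \<notin> X" "x \<notin> Y" "X \<inter> Y = {}"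
    and adj: "\<And>u v. u \<in> V \<Longrightarrow> v \<in> V \<Longrightarrow> {u, v} \<in> E \<longleftrightarrow> u \<noteq> v \<and>
      (u \<in> insert x X \<and> v \<in> insert x X \<or> u \<in> insert x Y \<and> v \<in> insert x Y)"
    using jc unfolding joined_cliques_def A_iff by blast+
  have f: "finite X" "finite Y" using V fin by auto
  obtain g where g: "bij_betw g X {1..?a}" using finite_same_card_bij[OF f(1), of "{1..?a}"] by auto
  obtain h where h: "bij_betw h Y {?a+1..?a+?b}" using finite_same_card_bij[OF f(2), of "{?a+1..?a+?b}"] by auto
  define F where "F u = (if u = x then 0 else if u \<in> X then g u else h u)" for u
  have Fx: "F x = 0" by (simp add: F_def)
  have FX: "F u = g u" "1 \<le> F u" "F u \<le> ?a" if "u \<in> X" for u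
    using that n bij_betwE[OF g] by (auto simp: F_def)
  have FY: "F u = h u" "?a < F u" "F u \<le> ?a + ?b" if "u \<in> Y" for u
    using that n bij_betwE[OF h] by (auto simp: F_def Suc_le_eq)
  have bij: "bij_betw F V {0..?a + ?b}"
  proof -
    have "bij_betw F {x} {0}" using Fx by (simp add: bij_betw_def)
    moreover have "bij_betw F X {1..?a}" using g bij_betw_cong[of X F g] FX(1) by simp
    moreover have "bij_betw F Y {?a+1..?a+?b}" using h bij_betw_cong[of Y F h] FY(1) by simp
    ultimately have "bij_betw F (({x} \<union> X) \<union> Y) (({0} \<union> {1..?a}) \<union> {?a+1..?a+?b})"
      by (intro bij_betw_combine) auto
    moreover have "({x} \<union> X) \<union> Y = V" using V by auto
    moreover have "({0} \<union> {1..?a}) \<union> {?a+1..?a+?b} = {0..?a + ?b}" by auto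
    ultimately show ?thesis by simp
  qed
  have le: "F u \<le> ?a + ?b" if "u \<in> V" for u using bij_betwE[OF bij] that by auto
  have inX: "F u \<le> ?a \<longleftrightarrow> u \<in> insert x X" if "u \<in> V" for u
    using that V n Fx FX(3)[of u] FY(2)[of u] by auto
  have inY: "F u = 0 \<or> ?a < F u \<longleftrightarrow> u \<in> insert x Y" if "u \<in> V" for u
    using that V n Fx FX(2,3)[of u] FY(2)[of u] by auto
  have inj: "F u = F v \<longleftrightarrow> u = v" if "u \<in> V" "v \<in> V" for u v
    using bij that by (auto simp: bij_betw_def inj_on_def)
  show ?thesis
    unfolding graph_iso_def join_verts_def
    using bij adj join_edges_iff[OF le le] inX inY inj by (intro exI[of _ F]) simp
qed

theorem theorem1p6:
  fixes V :: "'a set" and E :: "'a set set" and k n :: nat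
  assumes "k \<ge> 1"
    and "simple_graph V E"
    and "card V = n"
    and "2 * k + 2 \<le> n" and "n \<le> 4 * k + 1"
    and "card E \<ge> ((2 * k + 1) choose 2) + ((n - 2 * k) choose 2)"
    and "\<not> graph_iso V E (join_verts (2 * k) (n - 2 * k - 1)) (join_edges (2 * k) (n - 2 * k - 1))"
  shows "\<forall>l \<in> {2..k+1}. has_cycle V E (2 * l)"
proof
  fix l assume l: "l \<in> {2..k+1}"
  interpret sgraph "adj E" using assms(2) by (rule sgraph_adj)
  have fin: "finite V" using assms(2) by (simp add: simple_graph_def)
  define m where "m = n - 2 * k - 1"
  have m: "n = 2 * k + 1 + m" "m \<le> 2 * k" using assms(4,5) by (auto simp: m_def)
  have "2 * ((2 * k + 1) choose 2) + 2 * ((m + 1) choose 2) \<le> 2 * card E"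
    using assms(6) m(1) by simp
  then have "(2 * k + 1) * (2 * k) + (m + 1) * m \<le> arcs (adj E) V"
    unfolding two_choose_two arcs_adj[OF assms(2)] by simp
  then consider x X Y where "joined_cliques V x X Y" "card X = 2 * k"
    | "\<forall>L. even L \<longrightarrow> 4 \<le> L \<longrightarrow> L \<le> 2 * k + 2 \<longrightarrow> (\<exists>zs. cycle (adj E) V zs \<and> length zs = L)"
    using even_cycles_or_joined_cliques[OF assms(1) fin _ m(2)] assms(3) m(1) by blast
  then show "has_cycle V E (2 * l)"
  proof cases
    case 1
    have "card Y = m"
    proof -
      have "V = insert x (X \<union> Y)" "x \<notin> X" "x \<notin> Y" "X \<inter> Y = {}"
        using 1(1) by (auto simp: joined_cliques_def)
      moreover from this have "finite X" "finite Y" using fin finite_subset[of _ V] by auto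
      ultimately have "card V = Suc (card X + card Y)" by (simp add: card_Un_disjoint)
      then show ?thesis using assms(3) m(1) 1(2) by simp
    qed
    then show ?thesis using joined_cliques_iso[OF fin refl 1(1)] 1(2) assms(7) m_def by simp
  next
    case 2
    moreover have "even (2 * l)" "4 \<le> 2 * l" "2 * l \<le> 2 * k + 2" using l by auto
    ultimately obtain zs where "cycle (adj E) V zs" "length zs = 2 * l" by blast
    then show ?thesis using has_cycle_of_cycle[of E V zs] by simp
  qed
qed

end
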